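(* Consider a MIMO fluid antenna system (MIMO-FAS) in which the transmitter and receiver each have a planar fluid antenna surface of finite area $W_{tx}$, resp. $W_{rx}$, and activate $n_{tx}$, resp. $n_{rx}$, of their ports. Then the outer bound (upper bound on the achievable diversity gain) of the diversity-multiplexing tradeoff of MIMO-FAS is the piecewise linear function connecting the point $(n_{\min},0)$ and the points $$\left\{r,\ (N_{rx}'-r)(N_{tx}'-r)\right\},\qquad r=0,\ldots,N',$$ where $n_{\min}=\min\{n_{tx},n_{rx}\}$ and $$N'=\arg\min_{\eta\in\mathbb{Z},\,0\le\eta\le n_{\min}-1}\frac{(N_{rx}'-\eta)(N_{tx}'-\eta)}{n_{\min}-\eta}.$$
   Context: Setting: at side $s\in\{tx,rx\}$, the fluid antenna occupies a rectangle of size $\lambda W_1^s\times\lambda W_2^s$ ($\lambda$ the wavelength, $W_s=\lambda W_1^s\cdot\lambda W_2^s$) containing $N_s=N_1^s N_2^s$ ports on a uniform grid. The spatial correlation between ports $(n_1,n_2)$ and $(\tilde n_1,\tilde n_2)$ is $j_0\!\left(2\pi\sqrt{\left(\frac{|n_1-\tilde n_1|}{N_1^s-1}W_1^s\right)^2+\left(\frac{|n_2-\tilde n_2|}{N_2^s-1}W_2^s\right)^2}\right)$, with $j_0$ the zeroth-order spherical Bessel function of the first kind; these form the $N_s\times N_s$ symmetric matrix $\boldsymbol{J}_s=\boldsymbol{U}_s\boldsymbol{\Lambda}_s\boldsymbol{U}_s^H$ (eigendecomposition, eigenvalues in descending order). The channel is $\boldsymbol{H}=\delta\,\boldsymbol{U}_{rx}\sqrt{\boldsymbol{\Lambda}_{rx}}\boldsymbol{G}\sqrt{\boldsymbol{\Lambda}_{tx}^H}\boldsymbol{U}_{tx}^H$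 with $\boldsymbol{G}$ an $N_{rx}\times N_{tx}$ matrix of i.i.d. circularly symmetric complex Gaussian entries of unit variance and $\delta>0$ constant. $N_s'$ denotes the size of the full-rank symmetric reduced correlation matrix $\boldsymbol{J}^s_{\mathrm{red}}$ obtained from $\boldsymbol{J}_s$ by removing rows/columns that are identical to or linear combinations of others (i.e. $N_s'$ is the rank of $\boldsymbol{J}_s$). A MIMO-FAS scheme chooses $n_{rx}$ distinct receive ports and $n_{tx}$ distinct transmit ports (giving the submatrix $\bar{\boldsymbol{H}}=\boldsymbol{A}_{rx}\boldsymbol{H}\boldsymbol{A}_{tx}$ with $\boldsymbol{A}_s$ port-selection matrices), an input covariance $\boldsymbol{K}$ with $\mathrm{trace}(\boldsymbol{K})\le\mathrm{SNR}$, and achieves rate $\log\det(\boldsymbol{I}+\bar{\boldsymbol{H}}\boldsymbol{K}\bar{\boldsymbol{H}}^H)$ (noise has identity covariance). Diversity-multiplexing tradeoff: a scheme achieves multiplexing gain $r$ and diversity gain $d(r)$ if its rate satisfies $\lim_{\mathrm{SNR}\to\infty}R(\mathrm{SNR})/\log\mathrm{SNR}=r$ and its outage probability $P^{\mathrm{out}}(\mathrm{SNR},r)=\mathbb{P}\{R(\mathrm{SNR})<r\log\mathrm{SNR}\}$ satisfies $\lim_{\mathrm{SNR}\to\infty}\log P^{\mathrm{out}}(\mathrm{SNR},r)/\log\mathrm{SNR}=-d(r)$. *)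

theory Defs
  imports "HOL-Probability.Probability" "Jordan_Normal_Form.Schur_Decomposition"
          "Jordan_Normal_Form.DL_Rank"
begin

definition sph_j0 :: "real \<Rightarrow> real" where
  "sph_j0 x = (if x = 0 then 1 else sin x / x)"

text \<open>Ports of a side with \<open>N1 * N2\<close> ports are indexed by \<open>k < N1 * N2\<close>;
  port \<open>k\<close> is the grid point \<open>(k div N2, k mod N2)\<close>.  The correlation matrix
  \<open>J_s\<close> (real symmetric, \<open>N_s \<times> N_s\<close>).  W1, W2 are the side lengths in
  wavelengths.\<close>
definition corr_mat :: "real \<Rightarrow> real \<Rightarrow> nat \<Rightarrow> nat \<Rightarrow> real mat" where
  "corr_mat W1 W2 N1 N2 = Matrix.mat (N1 * N2) (N1 * N2) (\<lambda>(k, l).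
     sph_j0 (2 * pi * sqrt (
        (\<bar>real (k div N2) - real (l div N2)\<bar> / (real N1 - 1) * W1)\<^sup>2 +
        (\<bar>real (k mod N2) - real (l mod N2)\<bar> / (real N2 - 1) * W2)\<^sup>2)))"

text \<open>\<open>N_s'\<close>: size of the reduced full-rank correlation matrix = rank of \<open>J_s\<close>.\<close>
definition corr_rank :: "real \<Rightarrow> real \<Rightarrow> nat \<Rightarrow> nat \<Rightarrow> nat" where
  "corr_rank W1 W2 N1 N2 = vec_space.rank (N1 * N2) (corr_mat W1 W2 N1 N2)"

definition unitary_mat :: "complex mat \<Rightarrow> nat \<Rightarrow> bool" where
  "unitary_mat U n \<longleftrightarrow> U \<in> carrier_mat n n \<and> mat_adjoint U * U = 1\<^sub>m n"

definition diag_cmat :: "nat \<Rightarrow> (nat \<Rightarrow> complex) \<Rightarrow> complex mat" where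
  "diag_cmat n f = Matrix.mat n n (\<lambda>(i, j). if i = j then f i else 0)"

definition eigen_decomp :: "real mat \<Rightarrow> nat \<Rightarrow> complex mat \<Rightarrow> (nat \<Rightarrow> real) \<Rightarrow> bool" where
  "eigen_decomp J n U lam \<longleftrightarrow>
     unitary_mat U n \<and>
     map_mat complex_of_real J = U * diag_cmat n (\<lambda>i. complex_of_real (lam i)) * mat_adjoint U \<and>
     (\<forall>i j. i \<le> j \<longrightarrow> j < n \<longrightarrow> lam j \<le> lam i)"

definition sel_mat :: "nat \<Rightarrow> nat \<Rightarrow> (nat \<Rightarrow> nat) \<Rightarrow> complex mat" where
  "sel_mat n N p = Matrix.mat n N (\<lambda>(i, j). if j = p i then 1 else 0)"

definition valid_ports :: "nat \<Rightarrow> nat \<Rightarrow> (nat \<Rightarrow> nat) \<Rightarrow> bool" where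
  "valid_ports n N p \<longleftrightarrow> inj_on p {..<n} \<and> p ` {..<n} \<subseteq> {..<N}"

definition mat_trace :: "complex mat \<Rightarrow> complex" where
  "mat_trace A = (\<Sum>i<dim_row A. A $$ (i, i))"

definition admissible_cov :: "nat \<Rightarrow> real \<Rightarrow> complex mat \<Rightarrow> bool" where
  "admissible_cov n snr K \<longleftrightarrow> K \<in> carrier_mat n n \<and> mat_adjoint K = K \<and>
     (\<forall>v \<in> carrier_vec n. 0 \<le> Re ((K *\<^sub>v v) \<bullet>c v)) \<and> Re (mat_trace K) \<le> snr"

text \<open>Sample space: real and imaginary parts of the entries of \<open>G\<close>.
  \<open>\<omega> (i, j, True)\<close> / \<open>\<omega> (i, j, False)\<close> are the real / imaginary parts of \<open>G_{ij}\<close>,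
  each \<open>N(0, 1/2)\<close> and all independent, i.e. \<open>G_{ij}\<close> i.i.d. \<open>CN(0,1)\<close>.\<close>
definition gauss_space :: "nat \<Rightarrow> nat \<Rightarrow> (nat \<times> nat \<times> bool \<Rightarrow> real) measure" where
  "gauss_space Nr Nt = PiM ({..<Nr} \<times> {..<Nt} \<times> UNIV)
      (\<lambda>_. density lborel (normal_density 0 (sqrt (1/2))))"

definition gauss_mat :: "nat \<Rightarrow> nat \<Rightarrow> (nat \<times> nat \<times> bool \<Rightarrow> real) \<Rightarrow> complex mat" where
  "gauss_mat Nr Nt \<omega> = Matrix.mat Nr Nt (\<lambda>(i, j). Complex (\<omega> (i, j, True)) (\<omega> (i, j, False)))"

definition sqrt_diag :: "nat \<Rightarrow> (nat \<Rightarrow> real) \<Rightarrow> complex mat" where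
  "sqrt_diag n lam = diag_cmat n (\<lambda>i. complex_of_real (sqrt (lam i)))"

definition channel :: "real \<Rightarrow> nat \<Rightarrow> complex mat \<Rightarrow> (nat \<Rightarrow> real) \<Rightarrow> nat \<Rightarrow> complex mat
                       \<Rightarrow> (nat \<Rightarrow> real) \<Rightarrow> complex mat \<Rightarrow> complex mat" where
  "channel \<delta> Nr Urx lrx Nt Utx ltx G =
     complex_of_real \<delta> \<cdot>\<^sub>m (Urx * sqrt_diag Nr lrx * G * mat_adjoint (sqrt_diag Nt ltx) * mat_adjoint Utx)"

text \<open>Rate \<open>log det (I + Hbar K Hbar^H)\<close> (natural log; the base is irrelevant for the DMT).\<close>
definition mimo_rate :: "complex mat \<Rightarrow> complex mat \<Rightarrow> real" where
  "mimo_rate Hb K = ln (Re (Determinant.det (1\<^sub>m (dim_row Hb) + Hb * K * mat_adjoint Hb)))"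

definition dmt_pt :: "nat \<Rightarrow> nat \<Rightarrow> nat \<Rightarrow> real" where
  "dmt_pt Nr' Nt' k = (real Nr' - real k) * (real Nt' - real k)"

definition is_Nprime :: "nat \<Rightarrow> nat \<Rightarrow> nat \<Rightarrow> nat \<Rightarrow> bool" where
  "is_Nprime Nr' Nt' nmin Np \<longleftrightarrow> Np < nmin \<and>
     (\<forall>\<eta> < nmin. dmt_pt Nr' Nt' Np / (real nmin - real Np) \<le> dmt_pt Nr' Nt' \<eta> / (real nmin - real \<eta>))"

text \<open>Piecewise linear function through \<open>(k, dmt_pt k)\<close>, \<open>k = 0..N'\<close>, and \<open>(n_min, 0)\<close>,
  defined on \<open>[0, n_min]\<close>.\<close>
definition dmt_outer :: "nat \<Rightarrow> nat \<Rightarrow> nat \<Rightarrow> nat \<Rightarrow> real \<Rightarrow> real" where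
  "dmt_outer Nr' Nt' Np nmin r =
     (if r \<le> real Np then
        (let k = nat \<lfloor>r\<rfloor> in dmt_pt Nr' Nt' k + (r - real k) * (dmt_pt Nr' Nt' (Suc k) - dmt_pt Nr' Nt' k))
      else dmt_pt Nr' Nt' Np * (real nmin - r) / (real nmin - real Np))"

end

theory Submission
  imports Defs "HOL-Real_Asymp.Real_Asymp"
begin

text \<open>The spherical Bessel kernel is the Fourier transform of the uniform measure on the unit sphere.
  Hence \<open>\<Sum>k l. c k * c l * j0 (2 * pi * |x k - x l|)\<close> is the integral of \<open>|\<Sum>k. c k * exp (\<i> * (u \<bullet> x k))|\<^sup>2\<close>
  over \<open>u\<close> in a disc; exponentials with distinct frequencies are linearly independent, so the correlation
  matrices are positive definite and \<open>N' = N\<close> on both sides.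

  For the outage probability, choose exponents \<open>0 \<le> e 0 \<le> e 1 \<le> \<dots> \<le> 1\<close>. Gaussian elimination shows that
  with probability at least a constant times \<open>snr powr - (\<Sum>i j. e (min i j))\<close> the matrix \<open>G\<close> is a sum of rank-one
  matrices of sizes \<open>snr powr (- e p / 2)\<close>. The channel and its submatrices inherit such a decomposition, whatever ports are
  selected. Expanding the determinant in the rank-one terms, only products over distinct
  \<open>p\<close> survive, so the rate is at most \<open>(\<Sum>p<nmin. 1 - e p) * ln snr\<close> up to an additive constant. Exponents with two
  jumps give both kinds of segments of the outer bound.\<close>

section \<open>Definiteness of the spherical Bessel kernel\<close>

text \<open>Ports and covariance may be chosen after seeing the channel, so a bad event for one
  fixed submatrix says nothing about the best one. The event therefore constrains all of
  \<open>G\<close>, and a selection of dimension \<open>n\<close> profits at best from the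
  \<open>n\<close> strongest rank-one terms; this is why the exponents must not decrease, also
  beyond \<open>p = n\<close>. Elimination pivots stand in for singular values, so no joint
  eigenvalue density is needed: the entry \<open>(i, j)\<close> is constrained in step
  \<open>min i j\<close>, where its real and imaginary parts must each hit an interval of length
  \<open>2 * s (min i j)\<close>. With \<open>s p = snr powr (- e p / 2)\<close> the two together
  cost the exponent \<open>e (min i j)\<close>. Exponents 0 before \<open>k\<close> and 1 from
  \<open>k\<close> on cost one unit for each \<open>(i, j)\<close> with
  \<open>k \<le> min i j\<close>, and that count is the corner value
  \<open>(Nr - k) * (Nt - k)\<close>. Exponents stop at 1 because a term of squared size
  \<open>1 / snr\<close> already adds nothing to the leading order of the rate. All of this is in
  terms of the size of \<open>G\<close>; definiteness of the kernel identifies that size with the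
  ranks.\<close>

lemma sums_integral_of_uniform_bound:
  fixes f :: "nat \<Rightarrow> real \<Rightarrow> real"
  assumes cont: "\<And>n. continuous_on {a..b} (f n)"
    and bound: "\<And>n x. x \<in> {a..b} \<Longrightarrow> \<bar>f n x\<bar> \<le> M n" and "summable M"
    and sums: "\<And>x. x \<in> {a..b} \<Longrightarrow> (\<lambda>n. f n x) sums g x"
  shows "(\<lambda>n. integral {a..b} (f n)) sums integral {a..b} g"
proof -
  have "uniform_limit {a..b} (\<lambda>n x. \<Sum>i<n. f i x) (\<lambda>x. suminf (\<lambda>i. f i x)) sequentially"
    using bound \<open>summable M\<close> by (intro Weierstrass_m_test[where M=M]) auto
  then have u: "uniform_limit {a..b} (\<lambda>n x. \<Sum>i<n. f i x) g sequentially"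
    by (rule uniform_limit_cong[THEN iffD1, rotated -1]) (auto simp: sums_unique[OF sums, symmetric])
  have c: "continuous_on {a..b} (\<lambda>x. \<Sum>i<n. f i x)" for n
    by (intro continuous_on_sum cont)
  obtain I J where I: "\<And>n. ((\<lambda>x. \<Sum>i<n. f i x) has_integral I n) {a..b}"
    and J: "(g has_integral J) {a..b}" and "I \<longlonglongrightarrow> J"
    using uniform_limit_integral[OF u c] by auto
  have "I n = (\<Sum>i<n. integral {a..b} (f i))" for n
    using I[of n] integral_sum[of "{..<n}" f "{a..b}"] integrable_continuous_real[OF cont]
    by (metis finite_lessThan integral_unique)
  then have "I = (\<lambda>n. \<Sum>i<n. integral {a..b} (f i))" by auto
  with \<open>I \<longlonglongrightarrow> J\<close> J show ?thesis
    unfolding sums_def by (simp add: integral_unique)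
qed

section \<open>Circle and sphere averages of plane waves\<close>

text \<open>This is \<open>2 * pi\<close> times the Bessel function of order zero: the integral of
  the plane wave \<open>exp (\<i> * x)\<close> over the angle on a circle of radius
  \<open>z\<close>.\<close>

definition bessel_int :: "real \<Rightarrow> real" where
  "bessel_int z = integral {-pi..pi} (\<lambda>\<phi>. cos (z * cos \<phi>))"

text \<open>Wallis recursion: the two sides differ by the integral of the derivative of
  \<open>sin \<phi> * cos \<phi> ^ (2 * n + 1)\<close>, which vanishes at both ends.\<close>

lemma cos_moment_Suc:
  "(2 * real n + 2) * integral {-pi..pi} (\<lambda>\<phi>. cos \<phi> ^ (2 * Suc n))
     = (2 * real n + 1) * integral {-pi..pi} (\<lambda>\<phi>. cos \<phi> ^ (2 * n))"
proof -
  let ?f = "\<lambda>\<phi>. (2 * real n + 2) * cos \<phi> ^ (2 * Suc n) - (2 * real n + 1) * cos \<phi> ^ (2 * n)"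
  have "(?f has_integral (sin pi * cos pi ^ (2*n+1) - sin (-pi) * cos (-pi) ^ (2*n+1))) {-pi..pi}"
  proof (rule fundamental_theorem_of_calculus)
    fix x :: real
    have "((\<lambda>\<phi>. sin \<phi> * cos \<phi> ^ (2*n+1)) has_real_derivative
        cos x * cos x ^ (2*n+1) + sin x * (real (2*n+1) * cos x ^ (2*n) * (- sin x))) (at x)"
      using DERIV_mult[OF DERIV_sin DERIV_power[OF DERIV_cos, of "2*n+1"], of x] by (simp add: mult_ac)
    also have "cos x * cos x ^ (2*n+1) + sin x * (real (2*n+1) * cos x ^ (2*n) * (- sin x)) = ?f x"
    proof -
      have *: "sin x * sin x = 1 - cos x * cos x"
        using sin_cos_squared_add[of x] by (simp add: power2_eq_square)
      have "sin x * (real (2*n+1) * cos x ^ (2*n) * (- sin x))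
          = - (real (2*n+1) * cos x ^ (2*n)) * (sin x * sin x)"
        by simp
      also have "\<dots> = - (real (2*n+1) * cos x ^ (2*n)) * (1 - cos x * cos x)"
        by (simp only: *)
      finally have "cos x * cos x ^ (2*n+1) + sin x * (real (2*n+1) * cos x ^ (2*n) * (- sin x))
          = cos x * cos x ^ (2*n+1) - (real (2*n+1) * cos x ^ (2*n)) * (1 - cos x * cos x)"
        by simp
      also have "\<dots> = ?f x"
        by (simp add: algebra_simps)
      finally show ?thesis .
    qed
    finally show "((\<lambda>\<phi>. sin \<phi> * cos \<phi> ^ (2*n+1)) has_vector_derivative ?f x) (at x within {-pi..pi})"
      by (meson has_real_derivative_iff_has_vector_derivative has_vector_derivative_at_within)
  qed simp
  then have "integral {-pi..pi} ?f = 0" by (simp add: integral_unique)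
  moreover have "integral {-pi..pi} ?f = (2 * real n + 2) * integral {-pi..pi} (\<lambda>\<phi>. cos \<phi> ^ (2 * Suc n))
     - (2 * real n + 1) * integral {-pi..pi} (\<lambda>\<phi>. cos \<phi> ^ (2 * n))"
    by (subst integral_diff) (auto intro!: integrable_continuous_real continuous_intros)
  ultimately show ?thesis by simp
qed

text \<open>The two sides differ by the integral of the derivative of
  \<open>t * (1 - t\<^sup>2) ^ Suc n\<close>, which vanishes at 0 through the factor
  \<open>t\<close> and at 1 because the power is positive.\<close>

lemma one_minus_square_moment_Suc:
  "(2 * real n + 3) * integral {0..1} (\<lambda>t::real. (1 - t\<^sup>2) ^ Suc n)
     = (2 * real n + 2) * integral {0..1} (\<lambda>t::real. (1 - t\<^sup>2) ^ n)"
proof -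
  let ?f = "\<lambda>t::real. (2 * real n + 3) * (1 - t\<^sup>2) ^ Suc n - (2 * real n + 2) * (1 - t\<^sup>2) ^ n"
  have "(?f has_integral (1 * (1 - 1\<^sup>2) ^ Suc n - 0 * (1 - 0\<^sup>2) ^ Suc n)) {0..1}"
  proof (rule fundamental_theorem_of_calculus)
    fix x :: real
    have "((\<lambda>t::real. t * (1 - t\<^sup>2) ^ Suc n) has_real_derivative
        (1 - x\<^sup>2) ^ Suc n + x * (real (Suc n) * (1 - x\<^sup>2) ^ n * (- (2 * x)))) (at x)"
    proof -
      have "((\<lambda>t::real. 1 - t\<^sup>2) has_real_derivative - (2 * x)) (at x)"
        by (auto intro!: derivative_eq_intros)
      from DERIV_mult[OF DERIV_ident DERIV_power[OF this, of "Suc n"]] show ?thesis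
        by (simp add: mult_ac)
    qed
    also have "(1 - x\<^sup>2) ^ Suc n + x * (real (Suc n) * (1 - x\<^sup>2) ^ n * (- (2 * x))) = ?f x"
      by (simp add: algebra_simps power2_eq_square)
    finally show "((\<lambda>t. t * (1 - t\<^sup>2) ^ Suc n) has_vector_derivative ?f x) (at x within {0..1})"
      by (meson has_real_derivative_iff_has_vector_derivative has_vector_derivative_at_within)
  qed simp
  then have "integral {0..1} ?f = 0" by (simp add: integral_unique)
  moreover have "integral {0..1} ?f = (2 * real n + 3) * integral {0..1} (\<lambda>t::real. (1 - t\<^sup>2) ^ Suc n)
     - (2 * real n + 2) * integral {0..1} (\<lambda>t::real. (1 - t\<^sup>2) ^ n)"
    by (subst integral_diff) (auto intro!: integrable_continuous_real continuous_intros)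
  ultimately show ?thesis by simp
qed

text \<open>The recursions multiply by \<open>(2 n + 1) / (2 n + 2)\<close> and by
  \<open>(2 n + 2) / (2 n + 3)\<close>. In the product the even factors cancel and the rest
  telescopes.\<close>

lemma moment_product:
  "integral {-pi..pi} (\<lambda>\<phi>. cos \<phi> ^ (2 * n)) * integral {0..1} (\<lambda>t::real. (1 - t\<^sup>2) ^ n)
     = 2 * pi / (2 * real n + 1)"
proof (induction n)
  case 0
  show ?case by simp
next
  case (Suc n)
  let ?c = "\<lambda>n. integral {-pi..pi} (\<lambda>\<phi>. cos \<phi> ^ (2 * n))"
  let ?q = "\<lambda>n. integral {0..1} (\<lambda>t::real. (1 - t\<^sup>2) ^ n)"
  have "?c (Suc n) = (2 * real n + 1) * ?c n / (2 * real n + 2)"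
    using cos_moment_Suc[of n] by (simp add: field_simps del: mult_Suc_right power_Suc)
  moreover have "?q (Suc n) = (2 * real n + 2) * ?q n / (2 * real n + 3)"
    using one_minus_square_moment_Suc[of n] by (simp add: field_simps del: mult_Suc_right power_Suc)
  ultimately have "?c (Suc n) * ?q (Suc n)
      = ((2 * real n + 1) * ?c n / (2 * real n + 2)) * ((2 * real n + 2) * ?q n / (2 * real n + 3))"
    by (simp only:)
  also have "\<dots> = (2 * real n + 1) / (2 * real n + 3) * (?c n * ?q n)"
    by (simp add: divide_simps)
  also have "\<dots> = 2 * pi / (2 * real (Suc n) + 1)"
    unfolding Suc by (simp add: divide_simps)
  finally show ?case .
qed

lemma summable_even_exp: "summable (\<lambda>n. \<bar>z::real\<bar> ^ (2 * n) / fact (2 * n))"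
proof -
  have "summable (\<lambda>n. \<bar>z\<bar> ^ n / fact n)"
    using summable_exp_generic[of "\<bar>z\<bar>"] by (simp add: divide_inverse mult.commute)
  then have "summable ((\<lambda>n. \<bar>z\<bar> ^ n / fact n) \<circ> (\<lambda>n. 2 * n))"
    by (rule summable_reindex) (auto intro: injI)
  then show ?thesis by (simp add: o_def)
qed

lemma bessel_int_sums:
  "(\<lambda>n. (- 1) ^ n / fact (2 * n) * z ^ (2 * n) * integral {-pi..pi} (\<lambda>\<phi>. cos \<phi> ^ (2 * n)))
     sums bessel_int z"
proof -
  have "(\<lambda>n. integral {-pi..pi} (\<lambda>\<phi>. (- 1) ^ n / fact (2 * n) * (z * cos \<phi>) ^ (2 * n)))
     sums integral {-pi..pi} (\<lambda>\<phi>. cos (z * cos \<phi>))"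
  proof (rule sums_integral_of_uniform_bound[OF _ _ summable_even_exp[of z]])
    fix n \<phi>
    show "\<bar>(- 1) ^ n / fact (2 * n) * (z * cos \<phi>) ^ (2 * n)\<bar> \<le> \<bar>z\<bar> ^ (2 * n) / fact (2 * n)"
      using mult_left_mono[OF power_le_one[of "\<bar>cos \<phi>\<bar>" "2*n"], of "\<bar>z\<bar> ^ (2 * n)"]
      by (simp add: abs_mult power_abs[symmetric] power_mult_distrib divide_right_mono)
  qed (rule continuous_intros cos_paired)+
  then show ?thesis
    by (simp add: bessel_int_def power_mult_distrib mult.assoc)
qed

lemma continuous_on_bessel_int: "continuous_on S bessel_int"
proof -
  have "continuous_on S (\<lambda>z. integral (cbox (-pi) pi) (\<lambda>\<phi>. cos (z * cos \<phi>)))"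
    by (rule integral_continuous_on_param)
      (auto intro!: continuous_intros simp: split_beta)
  then show ?thesis
    unfolding bessel_int_def by (simp add: bessel_int_def[abs_def])
qed

text \<open>The factor \<open>1 / (2 n + 1)\<close> of \<open>moment_product\<close> turns the cosine series into the
  series of \<open>sin R / R\<close>; the variables \<open>t\<close> and \<open>\<phi>\<close> are cylindrical coordinates on the unit sphere.\<close>
lemma integral_bessel_int:
  "integral {0..1} (\<lambda>t. bessel_int (R * sqrt (1 - t\<^sup>2))) = 2 * pi * sph_j0 R"
proof -
  let ?c = "\<lambda>n. integral {-pi..pi} (\<lambda>\<phi>. cos \<phi> ^ (2 * n))"
  let ?q = "\<lambda>n. integral {0..1} (\<lambda>t::real. (1 - t\<^sup>2) ^ n)"
  have cb: "\<bar>?c n\<bar> \<le> 2 * pi" for n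
  proof -
    have "norm (?c n) \<le> 1 * (pi - (-pi))"
      by (rule integral_bound) (auto intro!: continuous_intros simp: power_abs power_le_one)
    then show ?thesis by simp
  qed
  have "(\<lambda>n. integral {0..1} (\<lambda>t. (- 1) ^ n / fact (2 * n) * (R * sqrt (1 - t\<^sup>2)) ^ (2 * n) * ?c n))
     sums integral {0..1} (\<lambda>t. bessel_int (R * sqrt (1 - t\<^sup>2)))"
  proof (rule sums_integral_of_uniform_bound[OF _ _ summable_mult2[OF summable_even_exp[of R], of "2 * pi"]])
    fix n :: nat and t :: real assume t: "t \<in> {0..1}"
    have "\<bar>(R * sqrt (1 - t\<^sup>2)) ^ (2 * n)\<bar> \<le> \<bar>R\<bar> ^ (2 * n)"
    proof -
      have "\<bar>sqrt (1 - t\<^sup>2)\<bar> \<le> 1" using t by (auto simp: power_le_one)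
      then show ?thesis
        unfolding power_abs abs_mult by (intro power_mono) (auto simp: mult_left_le)
    qed
    then show "\<bar>(- 1) ^ n / fact (2 * n) * (R * sqrt (1 - t\<^sup>2)) ^ (2 * n) * ?c n\<bar> \<le> \<bar>R\<bar> ^ (2 * n) / fact (2 * n) * (2 * pi)"
      unfolding abs_mult using cb[of n]
      by (intro mult_mono) (auto simp: divide_right_mono)
  qed (rule continuous_intros bessel_int_sums)+
  moreover have "integral {0..1} (\<lambda>t. (- 1) ^ n / fact (2 * n) * (R * sqrt (1 - t\<^sup>2)) ^ (2 * n) * ?c n)
      = 2 * pi * ((- 1) ^ n / fact (2 * n + 1) * R ^ (2 * n))" for n
  proof -
    have "integral {0..1} (\<lambda>t. (- 1) ^ n / fact (2 * n) * (R * sqrt (1 - t\<^sup>2)) ^ (2 * n) * ?c n)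
       = integral {0..1} (\<lambda>t. ((- 1) ^ n / fact (2 * n) * R ^ (2 * n) * ?c n) * (1 - t\<^sup>2) ^ n)"
      by (rule integral_cong) (auto simp: power_mult_distrib power_mult power_le_one)
    also have "\<dots> = (- 1) ^ n / fact (2 * n) * R ^ (2 * n) * (?c n * ?q n)"
      by simp
    also have "\<dots> = 2 * pi * ((- 1) ^ n / fact (2 * n + 1) * R ^ (2 * n))"
      unfolding moment_product by (simp add: field_simps)
    finally show ?thesis .
  qed
  ultimately have S: "(\<lambda>n. 2 * pi * ((- 1) ^ n / fact (2 * n + 1) * R ^ (2 * n)))
     sums integral {0..1} (\<lambda>t. bessel_int (R * sqrt (1 - t\<^sup>2)))"
    by simp
  have "(\<lambda>n. (- 1) ^ n / fact (2 * n + 1) * R ^ (2 * n)) sums sph_j0 R"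
  proof (cases "R = 0")
    case True
    then show ?thesis
      using powser_sums_zero[of "\<lambda>n. (- 1) ^ n / fact (2 * n + 1) :: real"]
      by (simp add: sph_j0_def power_mult)
  next
    case False
    have "(\<lambda>n. (- 1) ^ n / fact (2 * n + 1) * R ^ (2 * n + 1) / R) sums (sin R / R)"
      by (intro sums_divide sin_paired)
    then show ?thesis using False by (simp add: sph_j0_def)
  qed
  from sums_unique2[OF S sums_mult[OF this, of "2 * pi"]] show ?thesis .
qed

text \<open>With \<open>(a, b) = R * (cos \<psi>, sin \<psi>)\<close> the argument is
  \<open>R * cos (\<phi> - \<psi>)\<close>, and a shift does not change the integral over a full
  period.\<close>

lemma integral_cos_rotate:
  "integral {-pi..pi} (\<lambda>\<phi>. cos (a * cos \<phi> + b * sin \<phi>)) = bessel_int (sqrt (a\<^sup>2 + b\<^sup>2))"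
proof -
  define R where "R = sqrt (a\<^sup>2 + b\<^sup>2)"
  obtain \<psi> where \<psi>: "0 \<le> \<psi>" "\<psi> \<le> 2 * pi" "a = R * cos \<psi>" "b = R * sin \<psi>"
  proof (cases "R = 0")
    case True
    then have "a = 0" "b = 0" by (auto simp: R_def)
    then show ?thesis using that[of 0] True by simp
  next
    case False
    then have "(a / R)\<^sup>2 + (b / R)\<^sup>2 = 1"
      unfolding power_divide by (simp add: R_def add_divide_distrib[symmetric])
    from sincos_total_2pi[OF this] obtain t where "0 \<le> t" "t < 2 * pi" "a / R = cos t" "b / R = sin t"
      by blast
    then show ?thesis using that[of t] False by (simp add: field_simps)
  qed
  define h where "h = (\<lambda>x. cos (R * cos x))"
  have hint: "h integrable_on {u..v}" for u v
    unfolding h_def by (intro integrable_continuous_real continuous_intros)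
  have "integral {-pi..pi} (\<lambda>\<phi>. cos (a * cos \<phi> + b * sin \<phi>)) = integral {-pi..pi} (h \<circ> (+) (-\<psi>))"
    by (rule integral_cong) (simp add: h_def \<psi> cos_diff algebra_simps cos_add)
  also have "\<dots> = integral {-pi-\<psi>..pi-\<psi>} h"
    by (subst integral_shift_Icc_real) simp
  also have "\<dots> = integral {-pi-\<psi>..-pi} h + integral {-pi..pi-\<psi>} h"
    using \<psi> by (intro Henstock_Kurzweil_Integration.integral_combine[symmetric] hint) auto
  \<comment> \<open>The piece that the shift pushes below \<open>-pi\<close> is moved up by one
    period and fills the gap at the right end.\<close>
  also have "integral {-pi-\<psi>..-pi} h = integral {-pi-\<psi>..-pi} (h \<circ> (+) (2*pi))"
    by (rule integral_cong) (simp add: h_def cos_add)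
  also have "\<dots> = integral {pi-\<psi>..pi} h"
    by (subst integral_shift_Icc_real) (simp add: algebra_simps)
  also have "integral {pi-\<psi>..pi} h + integral {-pi..pi-\<psi>} h = integral {-pi..pi} h"
    using \<psi> by (subst add.commute, intro Henstock_Kurzweil_Integration.integral_combine hint) auto
  finally show ?thesis by (simp add: bessel_int_def h_def R_def)
qed

section \<open>Linear independence of exponentials and definiteness of the kernel\<close>

text \<open>The operator \<open>d/d\<rho> - \<i> * \<beta>\<close> maps the zero function to zero
  and multiplies the \<open>k\<close>-th term by \<open>\<i> * (b k - \<beta>)\<close>. It is
  applied once for each \<beta> in \<open>B\<close>.\<close>

lemma exp_sum_zero_times_diff:
  fixes c :: "'a \<Rightarrow> complex" and b :: "'a \<Rightarrow> real"
  assumes "finite B" and "finite S" and "u < v"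
    and zero: "\<And>\<rho>. u < \<rho> \<Longrightarrow> \<rho> < v \<Longrightarrow> (\<Sum>k\<in>S. c k * exp (\<i> * of_real (b k) * of_real \<rho>)) = 0"
    and "u < \<rho>" "\<rho> < v"
  shows "(\<Sum>k\<in>S. c k * (\<Prod>\<beta>\<in>B. of_real (b k - \<beta>)) * exp (\<i> * of_real (b k) * of_real \<rho>)) = 0"
  using \<open>finite B\<close> \<open>u < \<rho>\<close> \<open>\<rho> < v\<close>
proof (induction B arbitrary: \<rho>)
  case empty
  then show ?case using zero by simp
next
  case (insert \<gamma> B)
  let ?p = "\<lambda>k. c k * (\<Prod>\<beta>\<in>B. of_real (b k - \<beta>))"
  let ?g = "\<lambda>x. \<Sum>k\<in>S. ?p k * exp (\<i> * of_real (b k) * of_real x)"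
  have "(?g has_vector_derivative (\<Sum>k\<in>S. ?p k * (\<i> * of_real (b k) * exp (\<i> * of_real (b k) * of_real \<rho>)))) (at \<rho>)"
  proof (intro has_vector_derivative_sum has_vector_derivative_mult_right)
    fix k
    have "((\<lambda>z. exp (\<i> * of_real (b k) * z)) has_field_derivative
        \<i> * of_real (b k) * exp (\<i> * of_real (b k) * of_real \<rho>)) (at (of_real \<rho>))"
      by (auto intro!: derivative_eq_intros)
    from has_vector_derivative_real_field[OF this]
    show "((\<lambda>x. exp (\<i> * of_real (b k) * of_real x)) has_vector_derivative
        \<i> * of_real (b k) * exp (\<i> * of_real (b k) * of_real \<rho>)) (at \<rho>)"
      by (simp add: o_def)
  qed
  moreover have "(?g has_vector_derivative 0) (at \<rho>)"
    by (rule has_vector_derivative_transform_within_open[where S="{u<..<v}" and f="\<lambda>_. 0"])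
      (use insert in auto)
  ultimately have "(\<Sum>k\<in>S. ?p k * (\<i> * of_real (b k) * exp (\<i> * of_real (b k) * of_real \<rho>))) = 0"
    by (rule vector_derivative_unique_at)
  then have "\<i> * (\<Sum>k\<in>S. ?p k * of_real (b k) * exp (\<i> * of_real (b k) * of_real \<rho>)) = 0"
    by (simp add: sum_distrib_left mult_ac)
  then have "(\<Sum>k\<in>S. ?p k * of_real (b k) * exp (\<i> * of_real (b k) * of_real \<rho>)) - of_real \<gamma> * ?g \<rho> = 0"
    using insert by simp
  then show ?case
    using insert(1,2) by (simp add: sum_distrib_left sum_subtractf[symmetric] algebra_simps)
qed

lemma exp_sum_zero_imp_coeffs_zero:
  fixes c :: "'a \<Rightarrow> complex" and b :: "'a \<Rightarrow> real"
  assumes "finite S" and "u < v" and inj: "inj_on b S"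
    and zero: "\<And>\<rho>. u < \<rho> \<Longrightarrow> \<rho> < v \<Longrightarrow> (\<Sum>k\<in>S. c k * exp (\<i> * of_real (b k) * of_real \<rho>)) = 0"
    and "k \<in> S"
  shows "c k = 0"
proof -
  obtain \<rho> where \<rho>: "u < \<rho>" "\<rho> < v" using dense[OF \<open>u < v\<close>] by blast
  \<comment> \<open>Taking all other frequencies for \<open>B\<close> annihilates every term but the
    \<open>k\<close>-th, whose factor is nonzero because the frequencies are distinct.\<close>
  let ?B = "b ` (S - {k})"
  let ?t = "\<lambda>l. c l * (\<Prod>\<beta>\<in>?B. of_real (b l - \<beta>)) * exp (\<i> * of_real (b l) * of_real \<rho>)"
  have "(\<Sum>l\<in>S. ?t l) = 0"
    using exp_sum_zero_times_diff[OF _ \<open>finite S\<close> \<open>u < v\<close> zero \<rho>, where B="?B"] \<open>finite S\<close> by simp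
  moreover have "?t l = 0" if "l \<in> S - {k}" for l
    using that \<open>finite S\<close> by (auto simp: prod_zero_iff)
  then have "(\<Sum>l\<in>S. ?t l) = ?t k"
    using sum.remove[OF \<open>finite S\<close> \<open>k \<in> S\<close>, of ?t] sum.neutral[of "S - {k}" ?t] by simp
  moreover have "(\<Prod>\<beta>\<in>?B. complex_of_real (b k - \<beta>)) \<noteq> 0"
    using \<open>finite S\<close> inj \<open>k \<in> S\<close> by (auto simp: prod_zero_iff inj_on_def)
  ultimately show ?thesis by simp
qed

text \<open>Two distinct points have equal projections for at most one value of
  \<open>tan \<phi>\<close>, so only finitely many slopes are to be avoided.\<close>

lemma generic_direction:
  fixes X Y :: "'a \<Rightarrow> real"
  assumes "finite S" and dist: "\<And>k l. k \<in> S \<Longrightarrow> l \<in> S \<Longrightarrow> k \<noteq> l \<Longrightarrow> X k \<noteq> X l \<or> Y k \<noteq> Y l"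
  obtains \<phi> where "\<phi> \<in> {-pi..pi}" "inj_on (\<lambda>k. X k * cos \<phi> + Y k * sin \<phi>) S"
proof -
  \<comment> \<open>For \<open>Y k = Y l\<close> the quotient is 0 by the convention for division;
    such pairs never collide because \<open>cos \<phi> > 0\<close>.\<close>
  let ?bad = "(\<lambda>(k, l). - (X k - X l) / (Y k - Y l)) ` (S \<times> S)"
  have "finite ?bad" using \<open>finite S\<close> by simp
  then obtain e where e: "e \<notin> ?bad"
    using ex_new_if_finite[OF infinite_UNIV_char_0] by blast
  define \<phi> where "\<phi> = arctan e"
  have cpos: "cos \<phi> > 0" using cos_gt_zero_pi[of \<phi>] arctan_bounded[of e] by (simp add: \<phi>_def)
  have s: "sin \<phi> = e * cos \<phi>"
    using cpos tan_arctan[of e] by (simp add: tan_def \<phi>_def field_simps)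
  have "inj_on (\<lambda>k. X k * cos \<phi> + Y k * sin \<phi>) S"
  proof (rule inj_onI, rule ccontr)
    fix k l assume kl: "k \<in> S" "l \<in> S" "k \<noteq> l"
      and eq: "X k * cos \<phi> + Y k * sin \<phi> = X l * cos \<phi> + Y l * sin \<phi>"
    have "cos \<phi> * (X k - X l + e * (Y k - Y l)) = 0"
      using eq unfolding s by (simp add: algebra_simps)
    then have *: "X k - X l + e * (Y k - Y l) = 0" using cpos by simp
    show False
    proof (cases "Y k = Y l")
      case True
      then show ?thesis using * dist[OF kl] by simp
    next
      case False
      then have "e = - (X k - X l) / (Y k - Y l)" using * by (simp add: field_simps)
      then show ?thesis using e kl by auto
    qed
  qed
  moreover have "\<phi> \<in> {-pi..pi}"
    using arctan_bounded[of e] pi_gt_zero by (simp add: \<phi>_def)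
  ultimately show ?thesis using that by blast
qed

text \<open>The quadratic form is, up to the factor \<open>2 * pi\<close>, an integral over the
  height \<open>t\<close> of an integral over the angle of \<open>g\<close>. Here
  \<open>g \<rho> \<phi>\<close> is the squared modulus of the exponential sum at the frequency with
  polar coordinates \<open>(\<rho>, \<phi>)\<close>. All integrands are continuous and nonnegative,
  so they vanish.\<close>

lemma sinc_kernel_definite:
  fixes X Y c :: "'a \<Rightarrow> real"
  assumes fin: "finite S" and "W > 0"
    and dist: "\<And>k l. k \<in> S \<Longrightarrow> l \<in> S \<Longrightarrow> k \<noteq> l \<Longrightarrow> X k \<noteq> X l \<or> Y k \<noteq> Y l"
    and zero: "(\<Sum>k\<in>S. \<Sum>l\<in>S. c k * c l * sph_j0 (W * sqrt ((X k - X l)\<^sup>2 + (Y k - Y l)\<^sup>2))) = 0"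
    and "k \<in> S"
  shows "c k = 0"
proof -
  define D where "D = (\<lambda>k l. sqrt ((X k - X l)\<^sup>2 + (Y k - Y l)\<^sup>2))"
  define p where "p = (\<lambda>k \<phi>. X k * cos \<phi> + Y k * sin \<phi>)"
  define g where "g = (\<lambda>\<rho> \<phi>. (\<Sum>k\<in>S. c k * cos (\<rho> * p k \<phi>))\<^sup>2 + (\<Sum>k\<in>S. c k * sin (\<rho> * p k \<phi>))\<^sup>2)"
  define A where "A = (\<lambda>\<rho>. \<Sum>k\<in>S. \<Sum>l\<in>S. c k * c l * bessel_int (\<rho> * D k l))"
  have g_eq: "g \<rho> \<phi> = (\<Sum>k\<in>S. \<Sum>l\<in>S. c k * c l *
      cos ((\<rho> * (X k - X l)) * cos \<phi> + (\<rho> * (Y k - Y l)) * sin \<phi>))" for \<rho> \<phi>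
  proof -
    have "cos ((\<rho> * (X k - X l)) * cos \<phi> + (\<rho> * (Y k - Y l)) * sin \<phi>)
        = cos (\<rho> * p k \<phi>) * cos (\<rho> * p l \<phi>) + sin (\<rho> * p k \<phi>) * sin (\<rho> * p l \<phi>)" for k l
      unfolding cos_diff[symmetric] by (simp add: p_def algebra_simps)
    then show ?thesis
      unfolding g_def power2_eq_square sum_product sum.distrib[symmetric]
      by (intro sum.cong refl) (simp add: algebra_simps)
  qed
  have cont_g: "continuous_on T (g \<rho>)" for \<rho> T
    unfolding g_def p_def by (intro continuous_intros)
  have A_eq: "A \<rho> = integral {-pi..pi} (g \<rho>)" if "\<rho> \<ge> 0" for \<rho>
  proof -
    have "\<rho> * D k l = sqrt ((\<rho> * (X k - X l))\<^sup>2 + (\<rho> * (Y k - Y l))\<^sup>2)" for k l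
      using that by (simp add: D_def power_mult_distrib distrib_left[symmetric] real_sqrt_mult)
    then have "((\<lambda>\<phi>. cos ((\<rho> * (X k - X l)) * cos \<phi> + (\<rho> * (Y k - Y l)) * sin \<phi>))
        has_integral bessel_int (\<rho> * D k l)) {-pi..pi}" for k l
      unfolding integral_cos_rotate[symmetric]
      by (simp only: integral_cos_rotate[symmetric])
        (intro integrable_integral integrable_continuous_real continuous_intros)
    then have "(g \<rho> has_integral A \<rho>) {-pi..pi}"
      unfolding g_eq A_def by (intro has_integral_sum fin has_integral_mult_right)
    then show ?thesis by (simp add: integral_unique)
  qed
  have A_nonneg: "A \<rho> \<ge> 0" if "\<rho> \<ge> 0" for \<rho>
    unfolding A_eq[OF that] by (intro integral_nonneg integrable_continuous_real cont_g) (simp add: g_def)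
  have cont_A: "continuous_on T (\<lambda>t. A (W * sqrt (1 - t\<^sup>2)))" for T
    unfolding A_def
    by (intro continuous_intros continuous_on_compose2[OF continuous_on_bessel_int[of UNIV]]) auto
  have "((\<lambda>t. bessel_int (W * sqrt (1 - t\<^sup>2) * D k l)) has_integral 2 * pi * sph_j0 (W * D k l)) {0..1}" for k l
  proof -
    have "W * sqrt (1 - t\<^sup>2) * D k l = W * D k l * sqrt (1 - t\<^sup>2)" for t :: real by simp
    then show ?thesis
      unfolding integral_bessel_int[symmetric]
      by (simp only:) (intro integrable_integral integrable_continuous_real
          continuous_on_compose2[OF continuous_on_bessel_int[of UNIV]] continuous_intros, auto)
  qed
  then have "((\<lambda>t. A (W * sqrt (1 - t\<^sup>2))) has_integral
      (\<Sum>k\<in>S. \<Sum>l\<in>S. c k * c l * (2 * pi * sph_j0 (W * D k l)))) {0..1}"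
    unfolding A_def by (intro has_integral_sum fin has_integral_mult_right)
  then have "integral {0..1} (\<lambda>t. A (W * sqrt (1 - t\<^sup>2)))
      = 2 * pi * (\<Sum>k\<in>S. \<Sum>l\<in>S. c k * c l * sph_j0 (W * D k l))"
    by (simp add: integral_unique sum_distrib_left mult_ac)
  also have "\<dots> = 0" using zero by (simp add: D_def)
  finally have A0: "A (W * sqrt (1 - t\<^sup>2)) = 0" if "t \<in> {0..1}" for t
    using integral_eq_0_iff[OF cont_A, of 0 1] A_nonneg \<open>W > 0\<close> that
    by (auto simp: power_le_one)
  \<comment> \<open>The projection of the sphere of radius \<open>W\<close> to the plane covers
    every radius below \<open>W\<close>: the height \<open>sqrt (1 - (\<rho> / W)\<^sup>2)\<close>
    projects to \<rho>.\<close>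
  have gz: "g \<rho> \<phi> = 0" if "0 < \<rho>" "\<rho> < W" "\<phi> \<in> {-pi..pi}" for \<rho> \<phi>
  proof -
    have r: "0 \<le> \<rho> / W" "\<rho> / W \<le> 1" using that \<open>W > 0\<close> by auto
    then have "(\<rho> / W)\<^sup>2 \<le> 1" by (simp add: power_le_one)
    then have "W * sqrt (1 - (sqrt (1 - (\<rho> / W)\<^sup>2))\<^sup>2) = \<rho>" using r \<open>W > 0\<close> that by simp
    moreover have "sqrt (1 - (\<rho> / W)\<^sup>2) \<in> {0..1}" using \<open>(\<rho> / W)\<^sup>2 \<le> 1\<close> by simp
    ultimately have "A \<rho> = 0" using A0 by metis
    then have "integral {-pi..pi} (g \<rho>) = 0" using A_eq that by simp
    then show ?thesis
      using integral_eq_0_iff[OF cont_g, of "-pi" pi] that pi_gt_zero by (auto simp: g_def)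
  qed
  \<comment> \<open>Along one ray the frequencies are the projections of the points to its
    direction. A generic direction keeps them distinct and makes the problem
    one-dimensional.\<close>
  obtain \<phi> where \<phi>: "\<phi> \<in> {-pi..pi}" "inj_on (\<lambda>k. X k * cos \<phi> + Y k * sin \<phi>) S"
    by (rule generic_direction[OF fin dist])
  then have inj: "inj_on (\<lambda>k. p k \<phi>) S" by (simp add: p_def)
  have "(\<Sum>k\<in>S. complex_of_real (c k) * exp (\<i> * of_real (p k \<phi>) * of_real \<rho>)) = 0"
    if "0 < \<rho>" "\<rho> < W" for \<rho>
  proof -
    have "(\<Sum>k\<in>S. c k * cos (\<rho> * p k \<phi>)) = 0" "(\<Sum>k\<in>S. c k * sin (\<rho> * p k \<phi>)) = 0"
      using gz[OF that \<phi>(1)] by (simp_all add: g_def sum_power2_eq_zero_iff)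
    then show ?thesis
      by (auto simp: complex_eq_iff Re_exp Im_exp mult_ac)
  qed
  from exp_sum_zero_imp_coeffs_zero[OF fin \<open>W > 0\<close> inj this \<open>k \<in> S\<close>] show ?thesis by simp
qed

lemma corr_rank_eq:
  assumes "W1 > 0" "W2 > 0" "N1 \<ge> 1" "N2 \<ge> 1"
  shows "corr_rank W1 W2 N1 N2 = N1 * N2"
proof -
  define N where "N = N1 * N2"
  define J where "J = corr_mat W1 W2 N1 N2"
  define X where "X = (\<lambda>k. real (k div N2) / (real N1 - 1) * W1)"
  define Y where "Y = (\<lambda>k. real (k mod N2) / (real N2 - 1) * W2)"
  have J: "J \<in> carrier_mat N N" by (simp add: J_def corr_mat_def N_def)
  have Jkl: "J $$ (k, l) = sph_j0 (2 * pi * sqrt ((X k - X l)\<^sup>2 + (Y k - Y l)\<^sup>2))"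
    if "k < N" "l < N" for k l
  proof -
    have "(\<bar>x - y\<bar> / n * W)\<^sup>2 = (x / n * W - y / n * W)\<^sup>2" for x y n W :: real
      by (simp add: power_mult_distrib power_divide diff_divide_distrib[symmetric] left_diff_distrib[symmetric])
    then show ?thesis using that by (simp add: J_def corr_mat_def N_def X_def Y_def)
  qed
  \<comment> \<open>Ports that differ along an axis force at least two grid positions on it, so the
    divisor there is positive. On an axis with a single position division by zero yields the common
    coordinate 0.\<close>
  have dist: "X k \<noteq> X l \<or> Y k \<noteq> Y l" if "k < N" "l < N" "k \<noteq> l" for k l
  proof -
    have "k div N2 \<noteq> l div N2 \<or> k mod N2 \<noteq> l mod N2"
      using that by (metis div_mult_mod_eq)
    then show ?thesis
    proof
      assume ne: "k div N2 \<noteq> l div N2"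
      have "k div N2 < N1" "l div N2 < N1"
        using that by (simp_all add: N_def less_mult_imp_div_less)
      then have "real N1 - 1 > 0" using ne by linarith
      then show ?thesis using ne \<open>W1 > 0\<close> by (simp add: X_def)
    next
      assume ne: "k mod N2 \<noteq> l mod N2"
      have "k mod N2 < N2" "l mod N2 < N2" using assms by simp_all
      then have "real N2 - 1 > 0" using ne by linarith
      then show ?thesis using ne \<open>W2 > 0\<close> by (simp add: Y_def)
    qed
  qed
  have "Determinant.det J \<noteq> 0"
  proof
    assume "Determinant.det J = 0"
    then obtain v where v: "v \<in> carrier_vec N" "v \<noteq> 0\<^sub>v N" "J *\<^sub>v v = 0\<^sub>v N"
      using det_0_iff_vec_prod_zero_field[OF J] by blast
    have row: "(\<Sum>l<N. J $$ (k, l) * vec_index v l) = 0" if "k < N" for k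
    proof -
      have "vec_index (J *\<^sub>v v) k = 0" using v(3) that by simp
      then show ?thesis using that J v(1)
        by (simp add: scalar_prod_def atLeast0LessThan)
    qed
    have "(\<Sum>k<N. \<Sum>l<N. vec_index v k * vec_index v l * sph_j0 (2 * pi * sqrt ((X k - X l)\<^sup>2 + (Y k - Y l)\<^sup>2)))
       = (\<Sum>k<N. vec_index v k * (\<Sum>l<N. J $$ (k, l) * vec_index v l))"
      by (simp add: sum_distrib_left Jkl mult_ac)
    also have "\<dots> = 0" by (simp add: row)
    finally have z: "(\<Sum>k<N. \<Sum>l<N. vec_index v k * vec_index v l * sph_j0 (2 * pi * sqrt ((X k - X l)\<^sup>2 + (Y k - Y l)\<^sup>2))) = 0" .
    have "vec_index v k = 0" if "k < N" for k
      by (rule sinc_kernel_definite[OF _ _ _ z, of k]) (use dist that in auto)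
    then have "v = 0\<^sub>v N" using v(1) by (intro eq_vecI) auto
    then show False using v(2) by simp
  qed
  then show ?thesis
    using vec_space.det_rank_iff[OF J] by (simp add: corr_rank_def J_def N_def)
qed

section \<open>Determinants of sums of rank-one matrices\<close>

text \<open>Multilinearity in the rows; \<open>f\<close> records which summand each row
  takes.\<close>

lemma det_sum_rows_PiE:
  fixes c :: "nat \<Rightarrow> 'a \<Rightarrow> 'b :: comm_ring_1"
  assumes "finite P"
  shows "Determinant.det (Matrix.mat n n (\<lambda>(i, j). \<Sum>p\<in>P. c i p * v p j))
    = (\<Sum>f\<in>{..<n} \<rightarrow>\<^sub>E P. (\<Prod>i<n. c i (f i)) * Determinant.det (Matrix.mat n n (\<lambda>(i, j). v (f i) j)))"
proof -
  let ?S = "{q. q permutes {0..<n}}"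
  have lt: "q i < n" if "q \<in> ?S" "i < n" for q i
    using that permutes_in_image[of q "{0..<n}" i] by auto
  have "Determinant.det (Matrix.mat n n (\<lambda>(i, j). \<Sum>p\<in>P. c i p * v p j))
      = (\<Sum>q\<in>?S. signof q * (\<Prod>i<n. \<Sum>p\<in>P. c i p * v p (q i)))"
    by (subst det_def'[of _ n]) (auto simp: lt atLeast0LessThan intro!: sum.cong prod.cong)
  also have "\<dots> = (\<Sum>q\<in>?S. \<Sum>f\<in>{..<n} \<rightarrow>\<^sub>E P. (\<Prod>i<n. c i (f i)) * (signof q * (\<Prod>i<n. v (f i) (q i))))"
    using assms by (intro sum.cong refl)
      (simp add: prod_sum_PiE prod.distrib sum_distrib_left mult_ac)
  also have "\<dots> = (\<Sum>f\<in>{..<n} \<rightarrow>\<^sub>E P. (\<Prod>i<n. c i (f i)) * (\<Sum>q\<in>?S. signof q * (\<Prod>i<n. v (f i) (q i))))"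
    by (subst sum.swap) (simp add: sum_distrib_left)
  also have "\<dots> = (\<Sum>f\<in>{..<n} \<rightarrow>\<^sub>E P. (\<Prod>i<n. c i (f i)) * Determinant.det (Matrix.mat n n (\<lambda>(i, j). v (f i) j)))"
    by (intro sum.cong refl, subst det_def'[of _ n])
      (auto simp: lt atLeast0LessThan intro!: sum.cong prod.cong arg_cong2[where f="(*)"])
  finally show ?thesis .
qed

lemma det_not_inj_rows:
  fixes v :: "'a \<Rightarrow> nat \<Rightarrow> 'b :: comm_ring_1"
  assumes "\<not> inj_on f {..<n}"
  shows "Determinant.det (Matrix.mat n n (\<lambda>(i, j). v (f i) j)) = 0"
proof -
  obtain i j where "i < n" "j < n" "i \<noteq> j" "f i = f j"
    using assms by (auto simp: inj_on_def)
  then show ?thesis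
    by (intro det_identical_rows[of _ n i j]) (auto simp: Matrix.row_def intro!: Matrix.eq_vecI)
qed

lemma norm_det_le:
  fixes B :: "nat \<Rightarrow> nat \<Rightarrow> complex"
  assumes "\<And>i j. i < n \<Longrightarrow> j < n \<Longrightarrow> norm (B i j) \<le> b"
  shows "norm (Determinant.det (Matrix.mat n n (\<lambda>(i, j). B i j))) \<le> fact n * b ^ n"
proof -
  let ?S = "{q. q permutes {0..<n}}"
  have lt: "q i < n" if "q \<in> ?S" "i < n" for q i
    using that permutes_in_image[of q "{0..<n}" i] by auto
  have "Determinant.det (Matrix.mat n n (\<lambda>(i, j). B i j)) = (\<Sum>q\<in>?S. signof q * (\<Prod>i<n. B i (q i)))"
    by (subst det_def'[of _ n]) (auto simp: lt atLeast0LessThan intro!: sum.cong prod.cong)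
  also have "norm \<dots> \<le> (\<Sum>q\<in>?S. b ^ n)"
  proof (rule sum_norm_le)
    fix q assume q: "q \<in> ?S"
    have "norm (signof q * (\<Prod>i<n. B i (q i))) = (\<Prod>i<n. norm (B i (q i)))"
      by (simp add: norm_mult prod_norm sign_def)
    also have "\<dots> \<le> (\<Prod>i<n. b)"
      using assms lt[OF q] by (intro prod_mono) auto
    finally show "norm (signof q * (\<Prod>i<n. B i (q i))) \<le> b ^ n" by simp
  qed
  also have "\<dots> = fact n * b ^ n"
    by (simp add: card_permutations[OF refl])
  finally show ?thesis .
qed

text \<open>A choice \<open>f\<close> that uses a summand twice produces two equal rows, so in a
  surviving product each weight \<open>t p\<close> occurs at most once. Hence \<open>T\<close> has
  to bound products of distinct weights only; \<open>card P ^ n\<close> counts the choices.\<close>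

lemma norm_det_sum_rows_le:
  fixes c :: "nat \<Rightarrow> 'a \<Rightarrow> complex"
  assumes fin: "finite P" and "\<gamma> \<ge> 0" and t: "\<And>p. p \<in> P \<Longrightarrow> t p \<ge> 0" and "T \<ge> 0" "\<Delta> \<ge> 0"
    and c: "\<And>i p. i < n \<Longrightarrow> p \<in> P \<Longrightarrow> norm (c i p) \<le> \<gamma> * t p"
    and T: "\<And>f. f \<in> {..<n} \<rightarrow>\<^sub>E P \<Longrightarrow> inj_on f {..<n} \<Longrightarrow> (\<Prod>i<n. t (f i)) \<le> T"
    and v: "\<And>f. f \<in> {..<n} \<rightarrow>\<^sub>E P \<Longrightarrow> inj_on f {..<n} \<Longrightarrow>
      norm (Determinant.det (Matrix.mat n n (\<lambda>(i, j). v (f i) j))) \<le> \<Delta>"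
  shows "norm (Determinant.det (Matrix.mat n n (\<lambda>(i, j). \<Sum>p\<in>P. c i p * v p j)))
    \<le> real (card P) ^ n * (\<gamma> ^ n * T * \<Delta>)"
proof -
  have "norm (Determinant.det (Matrix.mat n n (\<lambda>(i, j). \<Sum>p\<in>P. c i p * v p j)))
     \<le> (\<Sum>f\<in>{..<n} \<rightarrow>\<^sub>E P. \<gamma> ^ n * T * \<Delta>)"
    unfolding det_sum_rows_PiE[OF fin]
  proof (rule sum_norm_le)
    fix f assume f: "f \<in> {..<n} \<rightarrow>\<^sub>E P"
    show "norm ((\<Prod>i<n. c i (f i)) * Determinant.det (Matrix.mat n n (\<lambda>(i, j). v (f i) j))) \<le> \<gamma> ^ n * T * \<Delta>"
    proof (cases "inj_on f {..<n}")
      case False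
      then show ?thesis using assms by (simp add: det_not_inj_rows)
    next
      case True
      have "(\<Prod>i<n. norm (c i (f i))) \<le> (\<Prod>i<n. \<gamma> * t (f i))"
        using f by (intro prod_mono) (auto intro!: c)
      also have "\<dots> = \<gamma> ^ n * (\<Prod>i<n. t (f i))" by (simp add: prod.distrib)
      also have "\<dots> \<le> \<gamma> ^ n * T" using T[OF f True] \<open>\<gamma> \<ge> 0\<close> by (intro mult_left_mono) auto
      finally show ?thesis
        unfolding norm_mult prod_norm[symmetric] using v[OF f True] \<open>T \<ge> 0\<close> \<open>\<gamma> \<ge> 0\<close> by (intro mult_mono) auto
    qed
  qed
  also have "\<dots> = real (card P) ^ n * (\<gamma> ^ n * T * \<Delta>)"
    by (simp add: card_PiE)
  finally show ?thesis .
qed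

text \<open>The matrix is \<open>A * D * K * D * B\<^sup>T\<close> with \<open>D = diag t\<close>.
  Expanding its rows along \<open>A\<close> leaves determinants whose rows are again weighted sums,
  and expanding those supplies the second factor \<open>T\<close>.\<close>

lemma norm_det_sandwich_le:
  fixes A B :: "nat \<Rightarrow> 'a \<Rightarrow> complex"
  assumes fin: "finite P" and "a \<ge> 0" "b \<ge> 0" and t: "\<And>p. p \<in> P \<Longrightarrow> t p \<ge> 0" and "T \<ge> 0"
    and A: "\<And>i p. i < n \<Longrightarrow> p \<in> P \<Longrightarrow> norm (A i p) \<le> a"
    and K: "\<And>p q. p \<in> P \<Longrightarrow> q \<in> P \<Longrightarrow> norm (K p q) \<le> \<kappa>" and "\<kappa> \<ge> 0"
    and B: "\<And>j q. j < n \<Longrightarrow> q \<in> P \<Longrightarrow> norm (B j q) \<le> b"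
    and T: "\<And>f. f \<in> {..<n} \<rightarrow>\<^sub>E P \<Longrightarrow> inj_on f {..<n} \<Longrightarrow> (\<Prod>i<n. t (f i)) \<le> T"
  shows "norm (Determinant.det (Matrix.mat n n (\<lambda>(i, j).
       \<Sum>p\<in>P. \<Sum>q\<in>P. A i p * of_real (t p) * (K p q * of_real (t q) * B j q))))
    \<le> real (card P) ^ (2 * n) * ((a * \<kappa> * b) ^ n * fact n) * T\<^sup>2"
proof -
  let ?v = "\<lambda>p j. \<Sum>q\<in>P. K p q * of_real (t q) * B j q"
  have "norm (Determinant.det (Matrix.mat n n (\<lambda>(i, j). ?v (f i) j)))
      \<le> real (card P) ^ n * (\<kappa> ^ n * T * (fact n * b ^ n))" if f: "f \<in> {..<n} \<rightarrow>\<^sub>E P" for f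
  proof -
    have "norm (Determinant.det (Matrix.mat n n (\<lambda>(i, j). B j (g i)))) \<le> fact n * b ^ n"
      if "g \<in> {..<n} \<rightarrow>\<^sub>E P" for g
      using that by (intro norm_det_le B) auto
    moreover have "norm (K (f i) q * of_real (t q)) \<le> \<kappa> * t q" if "i < n" "q \<in> P" for i q
      using f that t[of q] by (auto simp: norm_mult intro!: mult_right_mono K)
    ultimately show ?thesis
      using norm_det_sum_rows_le[OF fin \<open>\<kappa> \<ge> 0\<close> t \<open>T \<ge> 0\<close>, where \<Delta>="fact n * b ^ n" and n=n
          and c="\<lambda>i q. K (f i) q * of_real (t q)" and v="\<lambda>q j. B j q"] T \<open>b \<ge> 0\<close> by simp
  qed
  moreover have "norm (A i p * of_real (t p)) \<le> a * t p" if "i < n" "p \<in> P" for i p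
    using that t[of p] by (auto simp: norm_mult intro!: mult_right_mono A)
  ultimately have "norm (Determinant.det (Matrix.mat n n (\<lambda>(i, j).
       \<Sum>p\<in>P. A i p * of_real (t p) * ?v p j)))
     \<le> real (card P) ^ n * (a ^ n * T * (real (card P) ^ n * (\<kappa> ^ n * T * (fact n * b ^ n))))"
    using assms by - (rule norm_det_sum_rows_le[where t=t], auto)
  also have "\<dots> = real (card P) ^ (2 * n) * ((a * \<kappa> * b) ^ n * fact n) * T\<^sup>2"
    by (simp add: power_mult_distrib power2_eq_square mult_2 power_add)
  finally show ?thesis by (simp add: sum_distrib_left)
qed

text \<open>Induction removes the largest index of \<open>F\<close>, which is at least
  \<open>n\<close> when \<open>card F = Suc n\<close>. If \<open>F\<close> is smaller, the extra
  factor \<open>Y n\<close> is at least 1 and does no harm.\<close>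

lemma prod_le_prod_lessThan_card:
  fixes Y :: "nat \<Rightarrow> real"
  assumes "antimono Y" and "\<And>p. Y p \<ge> 1" and "finite F" "card F \<le> n"
  shows "(\<Prod>p\<in>F. Y p) \<le> (\<Prod>p<n. Y p)"
  using assms(3,4)
proof (induction n arbitrary: F)
  case 0
  then show ?case by simp
next
  case (Suc n)
  have Y0: "Y p \<ge> 0" for p using assms(2)[of p] by simp
  show ?case
  proof (cases "card F \<le> n")
    case True
    then have "(\<Prod>p\<in>F. Y p) \<le> (\<Prod>p<n. Y p)" using Suc by blast
    also have "\<dots> \<le> (\<Prod>p<n. Y p) * Y n"
      using mult_left_mono[OF assms(2)[of n] prod_nonneg[of "{..<n}" Y]] Y0 by simp
    finally show ?thesis by (simp add: mult.commute)
  next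
    case False
    then have card: "card F = Suc n" using Suc by simp
    then have "F \<noteq> {}" by auto
    let ?m = "Max F"
    have m: "?m \<in> F" using Suc.prems(1) \<open>F \<noteq> {}\<close> by simp
    have "F \<subseteq> {..?m}" using Suc.prems(1) by (auto intro: Max_ge)
    then have "card F \<le> Suc ?m" using card_mono[of "{..?m}" F] by simp
    then have "Y ?m \<le> Y n" using card \<open>antimono Y\<close> by (auto simp: antimono_def)
    moreover have "(\<Prod>p\<in>F - {?m}. Y p) \<le> (\<Prod>p<n. Y p)"
      using Suc.prems(1) m card by (intro Suc.IH) auto
    ultimately have "Y ?m * (\<Prod>p\<in>F - {?m}. Y p) \<le> Y n * (\<Prod>p<n. Y p)"
      using Y0 by (intro mult_mono) (auto intro: prod_nonneg)
    then show ?thesis using prod.remove[OF Suc.prems(1) m, of Y] by (simp add: mult.commute)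
  qed
qed

text \<open>The identity matrix is treated as \<open>n\<close> further rank-one terms of weight 1,
  indexed by \<open>Inl\<close>, which makes the middle matrix block diagonal. A choice of
  \<open>n\<close> distinct terms then mixes weights 1 and \<open>y p\<close>, whence the factors
  \<open>max 1 (y p)\<close>.\<close>

lemma norm_det_one_plus_le:
  fixes \<alpha> \<beta> :: "nat \<Rightarrow> nat \<Rightarrow> complex"
  assumes "a \<ge> 1" "b \<ge> 1" "\<kappa> \<ge> 1" and y: "\<And>p. y p \<ge> 0" and "antimono y"
    and \<alpha>: "\<And>i p. i < n \<Longrightarrow> p < m \<Longrightarrow> norm (\<alpha> i p) \<le> a"
    and \<kappa>: "\<And>p q. p < m \<Longrightarrow> q < m \<Longrightarrow> norm (k p q) \<le> \<kappa>"
    and \<beta>: "\<And>j q. j < n \<Longrightarrow> q < m \<Longrightarrow> norm (\<beta> j q) \<le> b"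
  shows "norm (Determinant.det (Matrix.mat n n (\<lambda>(i, j).
       (if i = j then 1 else 0) + (\<Sum>p<m. \<Sum>q<m. \<alpha> i p * of_real (y p) * (k p q * of_real (y q) * \<beta> j q)))))
    \<le> real (n + m) ^ (2 * n) * ((a * \<kappa> * b) ^ n * fact n) * (\<Prod>p<n. max 1 (y p))\<^sup>2"
proof -
  define P where "P = {..<n} <+> {..<m}"
  define t where "t = case_sum (\<lambda>_::nat. 1) y"
  define A where "A = (\<lambda>i. case_sum (\<lambda>l. if i = l then 1 else 0) (\<alpha> i))"
  define B where "B = (\<lambda>i. case_sum (\<lambda>l. if i = l then 1 else 0) (\<beta> i))"
  define K where "K = (\<lambda>p q. case p of Inl (l::nat) \<Rightarrow> (case q of Inl l' \<Rightarrow> if l = l' then 1 else 0 | Inr _ \<Rightarrow> 0)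
    | Inr p \<Rightarrow> (case q of Inl _ \<Rightarrow> 0 | Inr q \<Rightarrow> k p q))"
  have "finite P" by (simp add: P_def)
  have card: "card P = n + m" by (simp add: P_def card_Plus)
  have "(\<Sum>p\<in>P. \<Sum>q\<in>P. A i p * of_real (t p) * (K p q * of_real (t q) * B j q))
     = (if i = j then 1 else 0) + (\<Sum>p<m. \<Sum>q<m. \<alpha> i p * of_real (y p) * (k p q * of_real (y q) * \<beta> j q))"
    if "i < n" "j < n" for i j
  proof -
    have "(\<Sum>p<n. \<Sum>q<n. (if i = p then 1 else 0) * ((if p = q then 1 else 0) * (if j = q then 1 else 0)))
       = (if i = j then 1 else (0::complex))"
    proof -
      have "(\<Sum>p<n. \<Sum>q<n. (if i = p then 1 else 0) * ((if p = q then 1 else 0) * (if j = q then 1 else 0)))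
        = (\<Sum>p<n. if i = p then (if j = p then 1 else (0::complex)) else 0)"
        by (intro sum.cong refl) (use that in \<open>simp add: sum.delta if_distrib cong: if_cong\<close>)
      also have "\<dots> = (if j = i then 1 else 0)" using that by simp
      finally show ?thesis by auto
    qed
    then show ?thesis
      unfolding P_def by (simp add: sum.Plus A_def B_def K_def t_def)
  qed
  then have "Matrix.mat n n (\<lambda>(i, j). (if i = j then 1 else 0) +
        (\<Sum>p<m. \<Sum>q<m. \<alpha> i p * of_real (y p) * (k p q * of_real (y q) * \<beta> j q)))
      = Matrix.mat n n (\<lambda>(i, j). \<Sum>p\<in>P. \<Sum>q\<in>P. A i p * of_real (t p) * (K p q * of_real (t q) * B j q))"
    by (intro eq_matI) auto
  moreover have "norm (Determinant.det (Matrix.mat n n (\<lambda>(i, j).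
        \<Sum>p\<in>P. \<Sum>q\<in>P. A i p * of_real (t p) * (K p q * of_real (t q) * B j q))))
      \<le> real (card P) ^ (2 * n) * ((a * \<kappa> * b) ^ n * fact n) * (\<Prod>p<n. max 1 (y p))\<^sup>2"
  proof (rule norm_det_sandwich_le)
    fix f assume f: "f \<in> {..<n} \<rightarrow>\<^sub>E P" and inj: "inj_on f {..<n}"
    let ?F = "Inr -` (f ` {..<n})"
    have "(\<Prod>i<n. t (f i)) = (\<Prod>p\<in>f ` {..<n}. t p)" by (simp add: prod.reindex[OF inj])
    also have "\<dots> \<le> (\<Prod>p\<in>f ` {..<n}. case p of Inl _ \<Rightarrow> 1 | Inr p \<Rightarrow> max 1 (y p))"
      using y by (intro prod_mono) (auto simp: t_def split: sum.split)
    \<comment> \<open>Identity indices contribute factors 1 and drop out, which leaves a product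
      over at most \<open>n\<close> distinct \<open>p\<close>.\<close>
    also have "\<dots> = (\<Prod>p\<in>(Inr :: nat \<Rightarrow> nat + nat) ` ?F. case p of Inl _ \<Rightarrow> 1 | Inr p \<Rightarrow> max 1 (y p))"
      by (intro prod.mono_neutral_right) (auto split: sum.split)
    also have "\<dots> = (\<Prod>p\<in>?F. max 1 (y p))" by (subst prod.reindex) auto
    also have "\<dots> \<le> (\<Prod>p<n. max 1 (y p))"
    proof (rule prod_le_prod_lessThan_card)
      show "antimono (\<lambda>p. max 1 (y p))"
        using \<open>antimono y\<close> unfolding antimono_def by (metis max.mono order_refl)
      show "finite ?F" by (simp add: finite_vimageI)
      have "card ?F = card ((Inr :: nat \<Rightarrow> nat + nat) ` ?F)" by (rule card_image[OF inj_Inr, symmetric])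
      also have "\<dots> \<le> card (f ` {..<n})" by (intro card_mono) auto
      also have "\<dots> \<le> n" using card_image_le[of "{..<n}" f] by simp
      finally show "card ?F \<le> n" .
    qed simp
    finally show "(\<Prod>i<n. t (f i)) \<le> (\<Prod>p<n. max 1 (y p))" .
  next
    show "norm (K p q) \<le> \<kappa>" if "p \<in> P" "q \<in> P" for p q
      using that \<kappa> assms(1-3) by (auto simp: K_def P_def)
  qed (use assms in \<open>auto simp: P_def A_def B_def t_def intro!: prod_nonneg\<close>)
  ultimately show ?thesis by (simp add: card)
qed

text \<open>Two block triangularizations come from multiplying the same two block matrices in
  opposite orders. The identity is what passes from \<open>nr\<close> to \<open>nt\<close> when the
  transmit side is the smaller one.\<close>

lemma det_one_plus_mult_commute:
  fixes X Y :: "'a :: idom mat"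
  assumes X: "X \<in> carrier_mat n m" and Y: "Y \<in> carrier_mat m n"
  shows "Determinant.det (1\<^sub>m n + X * Y) = Determinant.det (1\<^sub>m m + Y * X)"
proof -
  let ?U = "four_block_mat (1\<^sub>m n) X (- Y) (1\<^sub>m m)"
  let ?V = "four_block_mat (1\<^sub>m n) (0\<^sub>m n m) Y (1\<^sub>m m)"
  have U: "?U \<in> carrier_mat (n + m) (n + m)" and V: "?V \<in> carrier_mat (n + m) (n + m)"
    using X Y by auto
  have "?U * ?V = four_block_mat (1\<^sub>m n + X * Y) X (0\<^sub>m m n) (1\<^sub>m m)"
    using X Y by (subst mult_four_block_mat[of _ n n _ m _ m _ _ n _ m]) auto
  then have 1: "Determinant.det (?U * ?V) = Determinant.det (1\<^sub>m n + X * Y)"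
    using X Y by (simp add: det_four_block_mat_lower_left_zero[of _ n _ m])
  have "?V * ?U = four_block_mat (1\<^sub>m n) X (0\<^sub>m m n) (1\<^sub>m m + Y * X)"
    using X Y by (subst mult_four_block_mat[of _ n n _ m _ m _ _ n _ m])
      (auto simp: comm_add_mat[of "1\<^sub>m m" m m])
  then have 2: "Determinant.det (?V * ?U) = Determinant.det (1\<^sub>m m + Y * X)"
    using X Y by (simp add: det_four_block_mat_lower_left_zero[of _ n _ m])
  show ?thesis
    using 1 2 det_mult[OF U V] det_mult[OF V U] by (simp add: mult.commute)
qed

section \<open>Gaussian matrices with prescribed pivots\<close>

text \<open>Indices outside \<open>S\<close> are allowed on purpose: there every element of the
  product space is \<open>undefined\<close>, so the coordinate is constant. Expressions in arbitrary
  coordinates can thus be handled for all \<open>S\<close> at once, as the induction over index sets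
  below requires.\<close>

lemma measurable_PiM_coordinate:
  assumes "sets N = sets (borel :: real measure)"
  shows "(\<lambda>\<omega>. \<omega> x) \<in> borel_measurable (PiM S (\<lambda>_. N))"
proof (cases "x \<in> S")
  case True
  then have "(\<lambda>\<omega>. \<omega> x) \<in> measurable (PiM S (\<lambda>_. N)) N" by (rule measurable_component_singleton)
  then show ?thesis using measurable_cong_sets[OF refl assms] by blast
next
  case False
  have "(\<lambda>\<omega>. \<omega> x) \<in> borel_measurable (PiM S (\<lambda>_. N)) \<longleftrightarrow> (\<lambda>\<omega>. undefined :: real) \<in> borel_measurable (PiM S (\<lambda>_. N))"
    by (rule measurable_cong) (use False in \<open>auto simp: space_PiM PiE_def extensional_def\<close>)
  then show ?thesis by simp
qed

text \<open>Fubini in the order of levels: once the other coordinates satisfy their constraints, the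
  interval for a coordinate of maximal level has a fixed center in \<open>[-B, B]\<close>, so it
  contributes a factor of at least \<open>w x\<close>.\<close>

lemma sequential_box_measure:
  fixes N :: "real measure" and lev :: "'i \<Rightarrow> nat" and f :: "'i \<Rightarrow> ('i \<Rightarrow> real) \<Rightarrow> real"
  assumes "finite I" and N: "prob_space N" "sets N = sets borel"
    and meas: "\<And>S x. f x \<in> borel_measurable (PiM S (\<lambda>_. N))"
    and indep: "\<And>x y v \<omega>. lev y \<le> lev x \<Longrightarrow> f y (fun_upd \<omega> x v) = f y \<omega>"
    and "\<And>x a. x \<in> I \<Longrightarrow> \<bar>a\<bar> \<le> B \<Longrightarrow> ennreal (w x) \<le> emeasure N {a - s x..a + s x}"
    and w: "\<And>x. w x \<ge> 0"
    and "\<And>x \<omega>. x \<in> I \<Longrightarrow> (\<forall>y\<in>I. lev y < lev x \<longrightarrow> \<bar>\<omega> y - f y \<omega>\<bar> \<le> s y) \<Longrightarrow> \<bar>f x \<omega>\<bar> \<le> B"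
  shows "ennreal (\<Prod>x\<in>I. w x) \<le>
    emeasure (PiM I (\<lambda>_. N)) {\<omega> \<in> space (PiM I (\<lambda>_. N)). \<forall>x\<in>I. \<bar>\<omega> x - f x \<omega>\<bar> \<le> s x}"
  using assms(1,6,8)
proof (induction I rule: finite_ranking_induct[where f=lev])
  case empty
  then show ?case by (simp add: space_PiM PiM_empty)
next
  case (insert x S)
  show ?case
  proof (cases "x \<in> S")
    case True
    then have eq: "insert x S = S" by auto
    show ?thesis
      unfolding eq by (rule insert.IH) (use insert.prems[unfolded eq] in auto)
  next
    case False
    interpret N: prob_space N by (rule N)
    interpret product_sigma_finite "\<lambda>_::'i. N" ..
    let ?E = "\<lambda>S. {\<omega> \<in> space (PiM S (\<lambda>_. N)). \<forall>x\<in>S. \<bar>\<omega> x - f x \<omega>\<bar> \<le> s x}"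
    note [measurable] = meas measurable_PiM_coordinate[OF N(2)]
    have spN: "space N = UNIV" using sets_eq_imp_space_eq[OF N(2)] by simp
    have E_meas: "?E S' \<in> sets (PiM S' (\<lambda>_. N))" if "finite S'" for S' :: "'i set"
      using that by measurable
    \<comment> \<open>Since \<open>x\<close> has maximal level, the constraints below a member of
      \<open>S\<close> never involve \<open>x\<close>, and the bound on the centers passes to the
      smaller index set.\<close>
    have less: "y \<in> S" if "y \<in> insert x S" "z \<in> S" "lev y < lev z" for y z
      using that insert(2)[of z] by auto
    have IH: "ennreal (\<Prod>y\<in>S. w y) \<le> emeasure (PiM S (\<lambda>_. N)) (?E S)"
    proof (rule insert.IH)
      fix z \<omega> assume "z \<in> S" "\<forall>y\<in>S. lev y < lev z \<longrightarrow> \<bar>\<omega> y - f y \<omega>\<bar> \<le> s y"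
      then show "\<bar>f z \<omega>\<bar> \<le> B" using less by (intro insert.prems(2)) auto
    qed (use insert in auto)
    \<comment> \<open>By \<open>indep\<close>, setting the coordinate \<open>x\<close> moves none of
      the centers, its own included.\<close>
    have ind: "indicator (?E S) \<omega> * indicator {f x \<omega> - s x..f x \<omega> + s x} v
        = (indicator (?E (insert x S)) (fun_upd \<omega> x v) :: ennreal)"
      if \<omega>: "\<omega> \<in> space (PiM S (\<lambda>_. N))" for \<omega> v
    proof -
      have "fun_upd \<omega> x v \<in> space (PiM (insert x S) (\<lambda>_. N))"
        using \<omega> by (auto simp: space_PiM spN PiE_def extensional_def)
      moreover have "f y (fun_upd \<omega> x v) = f y \<omega>" if "y \<in> insert x S" for y
        using that insert(2) by (intro indep) auto
      moreover have "(fun_upd \<omega> x v) y = \<omega> y" if "y \<in> S" for y using that False by auto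
      ultimately have "fun_upd \<omega> x v \<in> ?E (insert x S) \<longleftrightarrow> \<omega> \<in> ?E S \<and> v \<in> {f x \<omega> - s x..f x \<omega> + s x}"
        using \<omega> by (auto simp: abs_le_iff)
      then show ?thesis by (simp add: indicator_def)
    qed
    have "ennreal (\<Prod>y\<in>insert x S. w y) = ennreal (w x) * ennreal (\<Prod>y\<in>S. w y)"
      using False insert(1) w by (simp add: ennreal_mult prod_nonneg)
    also have "\<dots> \<le> ennreal (w x) * emeasure (PiM S (\<lambda>_. N)) (?E S)"
      by (intro mult_left_mono IH) auto
    also have "\<dots> = (\<integral>\<^sup>+\<omega>. ennreal (w x) * indicator (?E S) \<omega> \<partial>PiM S (\<lambda>_. N))"
      using E_meas[OF insert(1)] by (simp add: nn_integral_cmult)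
    also have "\<dots> \<le> (\<integral>\<^sup>+\<omega>. (\<integral>\<^sup>+v. indicator (?E (insert x S)) (fun_upd \<omega> x v) \<partial>N) \<partial>PiM S (\<lambda>_. N))"
    proof (rule nn_integral_mono)
      fix \<omega> assume \<omega>: "\<omega> \<in> space (PiM S (\<lambda>_. N))"
      have "ennreal (w x) * indicator (?E S) \<omega>
          \<le> indicator (?E S) \<omega> * emeasure N {f x \<omega> - s x..f x \<omega> + s x}"
      proof (cases "\<omega> \<in> ?E S")
        case True
        then have "\<bar>f x \<omega>\<bar> \<le> B" by (intro insert.prems(2)) auto
        then show ?thesis using insert.prems(1)[of x] True by simp
      qed simp
      also have "\<dots> = (\<integral>\<^sup>+v. indicator (?E S) \<omega> * indicator {f x \<omega> - s x..f x \<omega> + s x} v \<partial>N)"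
        by (rule nn_integral_cmult_indicator[symmetric]) (simp add: N(2))
      also have "\<dots> = (\<integral>\<^sup>+v. indicator (?E (insert x S)) (fun_upd \<omega> x v) \<partial>N)"
        by (simp only: ind[OF \<omega>])
      finally show "ennreal (w x) * indicator (?E S) \<omega> \<le> (\<integral>\<^sup>+v. indicator (?E (insert x S)) (fun_upd \<omega> x v) \<partial>N)" .
    qed
    also have "\<dots> = (\<integral>\<^sup>+\<omega>. indicator (?E (insert x S)) \<omega> \<partial>PiM (insert x S) (\<lambda>_. N))"
      using insert(1) False E_meas[of "insert x S"] by (subst product_nn_integral_insert) auto
    also have "\<dots> = emeasure (PiM (insert x S) (\<lambda>_. N)) (?E (insert x S))"
      using insert(1) E_meas[of "insert x S"] by simp
    finally show ?thesis .
  qed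
qed

text \<open>On the interval \<open>\<bar>x\<bar> \<le> B + 1\<close>, and there the density is at
  least its value at \<open>B + 1\<close>.\<close>

lemma gaussian_interval_ge:
  assumes "\<sigma> > 0" "0 \<le> s" "s \<le> 1" "\<bar>a\<bar> \<le> B"
  shows "ennreal (2 * normal_density 0 \<sigma> (B + 1) * s)
    \<le> emeasure (density lborel (normal_density 0 \<sigma>)) {a - s..a + s}"
proof -
  let ?c = "normal_density 0 \<sigma> (B + 1)"
  have "?c \<le> normal_density 0 \<sigma> x" if "x \<in> {a - s..a + s}" for x
  proof -
    have "\<bar>x\<bar> \<le> \<bar>B + 1\<bar>" using that assms by auto
    then have "x\<^sup>2 \<le> (B + 1)\<^sup>2" by (simp add: abs_le_square_iff)
    then show ?thesis
      unfolding normal_density_def using assms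
      by (intro mult_left_mono) (auto simp: divide_right_mono)
  qed
  then have "(\<integral>\<^sup>+x. ennreal ?c * indicator {a - s..a + s} x \<partial>lborel)
      \<le> (\<integral>\<^sup>+x. ennreal (normal_density 0 \<sigma> x) * indicator {a - s..a + s} x \<partial>lborel)"
    by (intro nn_integral_mono) (auto simp: indicator_def intro!: ennreal_leI)
  also have "\<dots> = emeasure (density lborel (normal_density 0 \<sigma>)) {a - s..a + s}"
    by (simp add: emeasure_density)
  finally show ?thesis
    using assms by (simp add: nn_integral_cmult ennreal_mult[symmetric] mult_ac)
qed

section \<open>Gaussian elimination without pivoting\<close>

text \<open>The first \<open>p\<close> rank-one terms of the elimination:
  \<open>G - lu_sum G p\<close> is the remainder after \<open>p\<close> steps, and the next term is
  built from its row and column \<open>p\<close>. A zero pivot contributes 0 by the convention for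
  division.\<close>

fun lu_sum :: "(nat \<Rightarrow> nat \<Rightarrow> complex) \<Rightarrow> nat \<Rightarrow> nat \<Rightarrow> nat \<Rightarrow> complex" where
  "lu_sum G 0 i j = 0"
| "lu_sum G (Suc p) i j = lu_sum G p i j +
     (G i p - lu_sum G p i p) * (G p j - lu_sum G p p j) / (G p p - lu_sum G p p p)"

text \<open>Only rows and columns below \<open>p\<close> are read in the first \<open>p\<close>
  steps. This triangular dependence is what allows the entries to be constrained in the order of
  \<open>min i j\<close>.\<close>

lemma lu_sum_cong:
  assumes "\<And>i j. min i j < p \<Longrightarrow> G i j = G' i j"
  shows "lu_sum G p = lu_sum G' p"
  using assms
proof (induction p)
  case (Suc p)
  then have "lu_sum G p = lu_sum G' p" by simp
  moreover have "G i p = G' i p" "G p i = G' p i" for i by (auto intro!: Suc.prems)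
  ultimately show ?case by (simp add: fun_eq_iff)
qed (simp add: fun_eq_iff)

text \<open>Rows and columns already cleared stay cleared, since one factor of the new term is zero
  for them. Row and column \<open>p\<close> are cleared by the new term because the pivot
  cancels.\<close>

lemma lu_sum_eq:
  assumes "\<And>q. q < p \<Longrightarrow> G q q - lu_sum G q q q \<noteq> 0" and "min i j < p"
  shows "lu_sum G p i j = G i j"
  using assms
proof (induction p arbitrary: i j)
  case (Suc p)
  have IH: "lu_sum G p i j = G i j" if "min i j < p" for i j
    using that Suc by auto
  have piv: "G p p - lu_sum G p p p \<noteq> 0" using Suc.prems(1)[of p] by simp
  consider "i < p" | "j < p" | "i = p" | "j = p" using Suc.prems(2) by linarith
  then show ?case
  proof cases
    case 1
    then have "lu_sum G p i j = G i j" "lu_sum G p i p = G i p" by (auto intro!: IH)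
    then show ?thesis by simp
  next
    case 2
    then have "lu_sum G p i j = G i j" "lu_sum G p p j = G p j" by (auto intro!: IH)
    then show ?thesis by simp
  qed (use piv in auto)
qed simp

lemma lu_sum_expand:
  "lu_sum G p i j = (\<Sum>q<p. (G i q - lu_sum G q i q) * (G q j - lu_sum G q q j) / (G q q - lu_sum G q q q))"
  by (induction p) auto

definition gauss_entry :: "(nat \<times> nat \<times> bool \<Rightarrow> real) \<Rightarrow> nat \<Rightarrow> nat \<Rightarrow> complex" where
  "gauss_entry \<omega> i j = Complex (\<omega> (i, j, True)) (\<omega> (i, j, False))"

text \<open>In the event below all pivots of Gaussian elimination are of exact order \<open>s p\<close>, and the \<open>p\<close>-th
  elimination step subtracts a rank-one matrix of size \<open>s p\<close>. The constraint on an entry depends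
  only on entries with a smaller value of \<open>min i j\<close>, and constrains it to an interval of length \<open>2 * s (min i j)\<close>.\<close>
definition box_center :: "(nat \<Rightarrow> real) \<Rightarrow> nat \<times> nat \<times> bool \<Rightarrow> (nat \<times> nat \<times> bool \<Rightarrow> real) \<Rightarrow> real" where
  "box_center s = (\<lambda>(i, j, b) \<omega>. let z = lu_sum (gauss_entry \<omega>) (min i j) i j in
     if b then Re z + (if i = j then 2 * s i else 0) else Im z)"

definition level :: "nat \<times> nat \<times> bool \<Rightarrow> nat" where
  "level = (\<lambda>(i, j, b). min i j)"

text \<open>The offset \<open>2 * s i\<close> in \<open>box_center\<close> keeps the real part of a
  pivot within \<open>[s i, 3 * s i]\<close>, away from zero. Adding an imaginary part of at most
  \<open>s i\<close> gives the constant 4.\<close>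

lemma gauss_entry_residual:
  assumes "\<forall>b. \<bar>\<omega> (i, j, b) - box_center s (i, j, b) \<omega>\<bar> \<le> s (min i j)" and "s (min i j) > 0"
  shows "norm (gauss_entry \<omega> i j - lu_sum (gauss_entry \<omega>) (min i j) i j) \<le> 4 * s (min i j)"
    and "i = j \<Longrightarrow> s i \<le> norm (gauss_entry \<omega> i i - lu_sum (gauss_entry \<omega>) i i i)"
proof -
  let ?z = "gauss_entry \<omega> i j - lu_sum (gauss_entry \<omega>) (min i j) i j"
  have re: "\<bar>Re ?z - (if i = j then 2 * s i else 0)\<bar> \<le> s (min i j)"
    using assms(1)[rule_format, of True] by (simp add: box_center_def gauss_entry_def algebra_simps)
  have im: "\<bar>Im ?z\<bar> \<le> s (min i j)"
    using assms(1)[rule_format, of False] by (simp add: box_center_def gauss_entry_def algebra_simps)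
  have "norm ?z \<le> \<bar>Re ?z\<bar> + \<bar>Im ?z\<bar>" by (rule cmod_le)
  also have "\<dots> \<le> 4 * s (min i j)" using re im assms(2) by (auto split: if_splits)
  finally show "norm ?z \<le> 4 * s (min i j)" .
  show "s i \<le> norm (gauss_entry \<omega> i i - lu_sum (gauss_entry \<omega>) i i i)" if "i = j"
    using re that abs_Re_le_cmod[of ?z] by auto
qed

lemma lu_step_bound:
  fixes x y z :: complex
  assumes "norm x \<le> 4 * s" "norm y \<le> 4 * s" "s \<le> norm z" "s > 0"
  shows "norm (x * y / z) \<le> 16 * s"
proof -
  have "norm (x * y / z) = norm x * norm y / norm z" by (simp add: norm_mult norm_divide)
  also have "\<dots> \<le> (4 * s) * (4 * s) / s" using assms by (intro frac_le mult_mono) auto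
  finally show ?thesis using assms by simp
qed

text \<open>Each step adds a term of norm at most \<open>(4 * s p)\<^sup>2 / s p = 16 * s p\<close>,
  hence at most 16. A bound independent of \<open>s\<close> keeps all centers in one fixed interval,
  on which the Gaussian density has a positive minimum.\<close>

lemma norm_lu_sum_le:
  assumes s: "\<And>p. 0 < s p" "\<And>p. s p \<le> 1"
    and "p \<le> min i j" "i < Nr" "j < Nt"
    and ev: "\<forall>x\<in>{..<Nr} \<times> {..<Nt} \<times> UNIV. level x < p \<longrightarrow> \<bar>\<omega> x - box_center s x \<omega>\<bar> \<le> s (level x)"
  shows "norm (lu_sum (gauss_entry \<omega>) p i j) \<le> 16 * real p"
  using assms(3,6)
proof (induction p)
  case (Suc p)
  let ?E = "\<lambda>i j. gauss_entry \<omega> i j - lu_sum (gauss_entry \<omega>) p i j"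
  have p: "p < i" "p < j" "p < Nr" "p < Nt" using Suc assms by auto
  have e: "\<forall>b. \<bar>\<omega> (i', j', b) - box_center s (i', j', b) \<omega>\<bar> \<le> s (min i' j')"
    if "i' < Nr" "j' < Nt" "min i' j' = p" for i' j'
    using Suc.prems(2) that by (force simp: level_def)
  have "norm (?E i p) \<le> 4 * s p"
    using gauss_entry_residual(1)[OF e, of i p] p assms by auto
  moreover have "norm (?E p j) \<le> 4 * s p"
    using gauss_entry_residual(1)[OF e, of p j] p assms by auto
  moreover have "s p \<le> norm (?E p p)"
    using gauss_entry_residual(2)[OF e, of p p] p assms by auto
  ultimately have "norm (?E i p * ?E p j / ?E p p) \<le> 16 * s p"
    using s by (intro lu_step_bound) auto
  moreover have "norm (lu_sum (gauss_entry \<omega>) p i j) \<le> 16 * real p"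
    using Suc by auto
  ultimately have "norm (lu_sum (gauss_entry \<omega>) p i j + ?E i p * ?E p j / ?E p p) \<le> 16 * real p + 16 * s p"
    by (intro norm_triangle_mono)
  then show ?case using s(2)[of p] by simp
qed simp

text \<open>The summand 2 accounts for the offset \<open>2 * s i\<close> on the diagonal.\<close>

lemma abs_box_center_le:
  assumes s: "\<And>p. 0 < s p" "\<And>p. s p \<le> 1" and x: "x \<in> {..<Nr} \<times> {..<Nt} \<times> UNIV"
    and ev: "\<forall>y\<in>{..<Nr} \<times> {..<Nt} \<times> UNIV. level y < level x \<longrightarrow> \<bar>\<omega> y - box_center s y \<omega>\<bar> \<le> s (level y)"
  shows "\<bar>box_center s x \<omega>\<bar> \<le> 16 * real Nr + 2"
proof -
  obtain i j b where x_def: "x = (i, j, b)" by (cases x)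
  then have ij: "i < Nr" "j < Nt" using x by auto
  let ?z = "lu_sum (gauss_entry \<omega>) (min i j) i j"
  have "norm ?z \<le> 16 * real (min i j)"
    by (rule norm_lu_sum_le[OF s _ ij]) (use ev in \<open>auto simp: x_def level_def\<close>)
  also have "\<dots> \<le> 16 * real Nr" using ij by simp
  finally have "norm ?z \<le> 16 * real Nr" .
  then have "\<bar>Re ?z\<bar> \<le> 16 * real Nr" "\<bar>Im ?z\<bar> \<le> 16 * real Nr"
    using abs_Re_le_cmod[of ?z] abs_Im_le_cmod[of ?z] by linarith+
  then show ?thesis
    using s(1)[of i] s(2)[of i] by (auto simp: x_def box_center_def Let_def)
qed

text \<open>After \<open>min Nr Nt\<close> steps nothing of \<open>G\<close> remains, so it is the
  sum of the elimination terms. In term \<open>q\<close> the column is divided by \<open>s q\<close>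
  and the row by the pivot, whose norm is at least \<open>s q\<close>; what is left over is the
  weight \<open>s q\<close>.\<close>

lemma gauss_entry_factorization:
  assumes s: "\<And>p. 0 < s p"
    and ev: "\<forall>x\<in>{..<Nr} \<times> {..<Nt} \<times> UNIV. \<bar>\<omega> x - box_center s x \<omega>\<bar> \<le> s (level x)"
  shows "\<exists>a b. (\<forall>q<min Nr Nt. (\<forall>i<Nr. norm (a q i) \<le> 4) \<and> (\<forall>j<Nt. norm (b q j) \<le> 4)) \<and>
    (\<forall>i<Nr. \<forall>j<Nt. gauss_entry \<omega> i j = (\<Sum>q<min Nr Nt. of_real (s q) * a q i * b q j))"
proof -
  define G where "G = gauss_entry \<omega>"
  define E where "E = (\<lambda>q i j. G i j - lu_sum G q i j)"
  have e: "\<forall>b. \<bar>\<omega> (i, j, b) - box_center s (i, j, b) \<omega>\<bar> \<le> s (min i j)"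
    if "i < Nr" "j < Nt" for i j
    using ev that by (force simp: level_def)
  have piv: "s q \<le> norm (E q q q)" if "q < min Nr Nt" for q
    using gauss_entry_residual(2)[OF e, of q q] that s by (auto simp: E_def G_def)
  have piv0: "E q q q \<noteq> 0" if "q < min Nr Nt" for q
    using piv[OF that] s[of q] by auto
  \<comment> \<open>The boxes bound the remainder of step \<open>q\<close> only where
    \<open>min i j = q\<close>. The other entries of row and column \<open>q\<close> were eliminated
    before and are zero.\<close>
  have low: "E q i j = 0" if "min i j < q" "q \<le> min Nr Nt" for q i j
    using lu_sum_eq[of q G i j] piv0 that by (auto simp: E_def)
  have col: "norm (E q i q) \<le> 4 * s q" if "q < min Nr Nt" "i < Nr" for q i
  proof (cases "i < q")
    case True
    then show ?thesis using low[of i q q] that s[of q] by auto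
  next
    case False
    then have "min i q = q" by simp
    then show ?thesis using gauss_entry_residual(1)[OF e, of i q] that s by (auto simp: E_def G_def)
  qed
  have row: "norm (E q q j) \<le> 4 * s q" if "q < min Nr Nt" "j < Nt" for q j
  proof (cases "j < q")
    case True
    then show ?thesis using low[of q j q] that s[of q] by auto
  next
    case False
    then have "min q j = q" by simp
    then show ?thesis using gauss_entry_residual(1)[OF e, of q j] that s by (auto simp: E_def G_def)
  qed
  let ?a = "\<lambda>q i. E q i q / of_real (s q)" and ?b = "\<lambda>q j. E q q j / E q q q"
  have A: "norm (?a q i) \<le> 4" if "q < min Nr Nt" "i < Nr" for q i
    using col[OF that] s[of q] by (simp add: norm_divide field_simps)
  have B: "norm (?b q j) \<le> 4" if "q < min Nr Nt" "j < Nt" for q j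
  proof -
    have "norm (E q q j) \<le> 4 * norm (E q q q)" using row[OF that] piv[OF that(1)] by linarith
    then show ?thesis using piv0[OF that(1)] by (simp add: norm_divide field_simps)
  qed
  have AB: "G i j = (\<Sum>q<min Nr Nt. of_real (s q) * ?a q i * ?b q j)" if "i < Nr" "j < Nt" for i j
  proof -
    have "min i j < min Nr Nt" using that by auto
    then have "G i j = lu_sum G (min Nr Nt) i j"
      using lu_sum_eq[of "min Nr Nt" G i j] piv0 by (auto simp: E_def)
    also have "\<dots> = (\<Sum>q<min Nr Nt. E q i q * E q q j / E q q q)"
      unfolding lu_sum_expand[of G "min Nr Nt"] E_def ..
    also have "\<dots> = (\<Sum>q<min Nr Nt. of_real (s q) * ?a q i * ?b q j)"
      using s by (intro sum.cong refl) (simp add: less_imp_neq[THEN not_sym])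
    finally show ?thesis .
  qed
  show ?thesis
    unfolding G_def[symmetric]
    by (intro exI[of _ ?a] exI[of _ ?b] conjI allI impI) (rule A B AB; assumption)+
qed

lemma measurable_lu_sum:
  assumes N: "sets N = sets (borel :: real measure)"
  shows "(\<lambda>\<omega>. lu_sum (gauss_entry \<omega>) p i j) \<in> borel_measurable (PiM S (\<lambda>_. N))"
proof -
  note [measurable] = measurable_PiM_coordinate[OF N]
  have G: "(\<lambda>\<omega>. gauss_entry \<omega> i j) \<in> borel_measurable (PiM S (\<lambda>_. N))" for i j
    unfolding gauss_entry_def Complex_eq by measurable
  note [measurable] = G
  show ?thesis
    by (induction p arbitrary: i j) auto
qed

text \<open>The constant is a power of twice the minimal density over the fixed range of centers, so
  it precedes \<open>s\<close>. The squares arise because each complex entry has two independent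
  real coordinates.\<close>

lemma gauss_event_measure:
  obtains c where "c > 0"
    "\<And>s. (\<And>p. 0 < s p) \<Longrightarrow> (\<And>p. s p \<le> 1) \<Longrightarrow> \<exists>E\<in>sets (gauss_space Nr Nt).
       c * (\<Prod>i<Nr. \<Prod>j<Nt. (s (min i j))\<^sup>2) \<le> measure (gauss_space Nr Nt) E \<and>
       (\<forall>\<omega>\<in>E. \<exists>a b. (\<forall>q<min Nr Nt. (\<forall>i<Nr. norm (a q i) \<le> 4) \<and> (\<forall>j<Nt. norm (b q j) \<le> 4)) \<and>
          (\<forall>i<Nr. \<forall>j<Nt. gauss_entry \<omega> i j = (\<Sum>q<min Nr Nt. of_real (s q) * a q i * b q j)))"
proof -
  define I :: "(nat \<times> nat \<times> bool) set" where "I = {..<Nr} \<times> {..<Nt} \<times> UNIV"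
  define N where "N = density lborel (normal_density 0 (sqrt (1/2)))"
  define B where "B = 16 * real Nr + 2"
  define c where "c = 2 * normal_density 0 (sqrt (1/2)) (B + 1)"
  have "c > 0" unfolding c_def by (simp add: normal_density_pos)
  have N: "prob_space N" "sets N = sets borel"
    unfolding N_def by (auto intro!: prob_space_normal_density)
  have M: "gauss_space Nr Nt = PiM I (\<lambda>_. N)" by (simp add: gauss_space_def I_def N_def)
  interpret N: prob_space N by (rule N)
  interpret M: prob_space "gauss_space Nr Nt"
    unfolding M by (intro prob_space_PiM N)
  have "finite I" by (simp add: I_def)
  have prod_I: "(\<Prod>x\<in>I. c * s (level x)) = c ^ card I * (\<Prod>i<Nr. \<Prod>j<Nt. (s (min i j))\<^sup>2)" for s
  proof -
    have "(\<Prod>x\<in>I. s (level x)) = (\<Prod>i<Nr. \<Prod>j<Nt. \<Prod>b\<in>(UNIV :: bool set). s (level (i, j, b)))"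
      by (simp add: I_def prod.cartesian_product case_prod_unfold)
    also have "\<dots> = (\<Prod>i<Nr. \<Prod>j<Nt. (s (min i j))\<^sup>2)"
      by (simp add: level_def UNIV_bool power2_eq_square)
    finally show ?thesis by (simp add: prod.distrib)
  qed
  show ?thesis
  proof (rule that[of "c ^ card I"])
    fix s :: "nat \<Rightarrow> real" assume s: "\<And>p. 0 < s p" "\<And>p. s p \<le> 1"
    let ?E = "{\<omega> \<in> space (PiM I (\<lambda>_. N)). \<forall>x\<in>I. \<bar>\<omega> x - box_center s x \<omega>\<bar> \<le> s (level x)}"
    have meas: "box_center s x \<in> borel_measurable (PiM S (\<lambda>_. N))" for S x
    proof -
      obtain i j b where x: "x = (i, j, b)" by (cases x)
      note [measurable] = measurable_lu_sum[OF N(2)]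
      show ?thesis unfolding x box_center_def Let_def prod.case by measurable
    qed
    note [measurable] = meas measurable_PiM_coordinate[OF N(2)]
    have "?E \<in> sets (PiM I (\<lambda>_. N))" using \<open>finite I\<close> by measurable
    moreover have "ennreal (\<Prod>x\<in>I. c * s (level x)) \<le> emeasure (PiM I (\<lambda>_. N)) ?E"
    proof (rule sequential_box_measure[where B=B and lev=level])
      show "box_center s y (fun_upd \<omega> x v) = box_center s y \<omega>" if "level y \<le> level x" for x y v \<omega>
      proof -
        obtain i j b where y: "y = (i, j, b)" by (cases y)
        obtain i' j' b' where x: "x = (i', j', b')" by (cases x)
        have "lu_sum (gauss_entry (fun_upd \<omega> x v)) (min i j) = lu_sum (gauss_entry \<omega>) (min i j)"
          by (rule lu_sum_cong) (use that in \<open>auto simp: gauss_entry_def x y level_def\<close>)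
        then show ?thesis by (simp add: y box_center_def)
      qed
      show "ennreal (c * s (level x)) \<le> emeasure N {a - s (level x)..a + s (level x)}" if "\<bar>a\<bar> \<le> B" for x a
        using gaussian_interval_ge[of "sqrt (1/2)" "s (level x)" a B] that s[of "level x"]
        by (simp add: N_def c_def less_imp_le)
      show "\<bar>box_center s x \<omega>\<bar> \<le> B"
        if "x \<in> I" "\<forall>y\<in>I. level y < level x \<longrightarrow> \<bar>\<omega> y - box_center s y \<omega>\<bar> \<le> s (level y)" for x \<omega>
        using abs_box_center_le[of s x Nr Nt \<omega>] s that by (simp add: B_def I_def)
    qed (use \<open>finite I\<close> N meas \<open>c > 0\<close> s in \<open>auto intro!: mult_nonneg_nonneg less_imp_le\<close>)
    then have "c ^ card I * (\<Prod>i<Nr. \<Prod>j<Nt. (s (min i j))\<^sup>2) \<le> measure (gauss_space Nr Nt) ?E"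
      unfolding prod_I M[symmetric] by (simp add: M.emeasure_eq_measure)
    moreover have "\<exists>a b. (\<forall>q<min Nr Nt. (\<forall>i<Nr. norm (a q i) \<le> 4) \<and> (\<forall>j<Nt. norm (b q j) \<le> 4)) \<and>
          (\<forall>i<Nr. \<forall>j<Nt. gauss_entry \<omega> i j = (\<Sum>q<min Nr Nt. of_real (s q) * a q i * b q j))"
      if "\<omega> \<in> ?E" for \<omega>
      using gauss_entry_factorization[of s Nr Nt \<omega>] s that by (simp add: I_def)
    ultimately show "\<exists>E\<in>sets (gauss_space Nr Nt).
       c ^ card I * (\<Prod>i<Nr. \<Prod>j<Nt. (s (min i j))\<^sup>2) \<le> measure (gauss_space Nr Nt) E \<and>
       (\<forall>\<omega>\<in>E. \<exists>a b. (\<forall>q<min Nr Nt. (\<forall>i<Nr. norm (a q i) \<le> 4) \<and> (\<forall>j<Nt. norm (b q j) \<le> 4)) \<and>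
          (\<forall>i<Nr. \<forall>j<Nt. gauss_entry \<omega> i j = (\<Sum>q<min Nr Nt. of_real (s q) * a q i * b q j)))"
      unfolding M by blast
  qed (use \<open>c > 0\<close> in simp)
qed

section \<open>The rate of a selected subchannel\<close>

lemma mat_adjoint_carrier:
  fixes A :: "complex mat"
  assumes "A \<in> carrier_mat n m"
  shows "mat_adjoint A \<in> carrier_mat m n"
  using assms unfolding mat_adjoint_def by auto

lemma mat_adjoint_index:
  fixes A :: "complex mat"
  assumes "A \<in> carrier_mat n m" "i < m" "j < n"
  shows "mat_adjoint A $$ (i, j) = cnj (A $$ (j, i))"
  using assms unfolding mat_adjoint_def by (simp add: mat_of_rows_index)

lemma mult_mat_index_sum:
  assumes "A \<in> carrier_mat n m" "B \<in> carrier_mat m l" "i < n" "j < l"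
  shows "(A * B) $$ (i, j) = (\<Sum>k<m. A $$ (i, k) * B $$ (k, j))"
  using assms by (simp add: scalar_prod_def atLeast0LessThan)

lemma cscalar_prod_mat_adjoint:
  fixes A :: "complex mat"
  assumes A: "A \<in> carrier_mat n m" and x: "x \<in> carrier_vec m" and v: "v \<in> carrier_vec n"
  shows "(A *\<^sub>v x) \<bullet>c v = x \<bullet>c (mat_adjoint A *\<^sub>v v)"
proof -
  note Aa = mat_adjoint_carrier[OF A]
  have "(A *\<^sub>v x) \<bullet>c v = (\<Sum>i<n. (\<Sum>u<m. A $$ (i, u) * vec_index x u) * cnj (vec_index v i))"
    using A x v by (simp add: scalar_prod_def atLeast0LessThan)
  also have "\<dots> = (\<Sum>i<n. \<Sum>u<m. vec_index x u * (A $$ (i, u) * cnj (vec_index v i)))"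
    by (intro sum.cong refl) (simp add: sum_distrib_left sum_distrib_right mult_ac)
  also have "\<dots> = (\<Sum>u<m. vec_index x u * (\<Sum>i<n. A $$ (i, u) * cnj (vec_index v i)))"
    unfolding sum_distrib_left by (rule sum.swap)
  also have "\<dots> = x \<bullet>c (mat_adjoint A *\<^sub>v v)"
    using Aa v by (simp add: scalar_prod_def atLeast0LessThan mat_adjoint_index[OF A])
  finally show ?thesis .
qed

lemma quadratic_form_sum:
  fixes K :: "complex mat"
  assumes "K \<in> carrier_mat n n" "w \<in> carrier_vec n"
  shows "(K *\<^sub>v w) \<bullet>c w = (\<Sum>i<n. \<Sum>j<n. K $$ (i, j) * vec_index w j * cnj (vec_index w i))"
  using assms by (simp add: scalar_prod_def atLeast0LessThan sum_distrib_right)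

lemma hermitian_quadratic_form_real:
  fixes K :: "complex mat"
  assumes K: "K \<in> carrier_mat n n" "mat_adjoint K = K" and w: "w \<in> carrier_vec n"
  shows "Im ((K *\<^sub>v w) \<bullet>c w) = 0"
proof -
  let ?q = "\<lambda>i j. K $$ (i, j) * vec_index w j * cnj (vec_index w i)"
  have herm: "cnj (K $$ (i, j)) = K $$ (j, i)" if "i < n" "j < n" for i j
    using mat_adjoint_index[OF K(1), of j i] K(2) that by simp
  have "cnj (\<Sum>i<n. \<Sum>j<n. ?q i j) = (\<Sum>i<n. \<Sum>j<n. ?q j i)"
    by (simp add: herm mult_ac)
  also have "\<dots> = (\<Sum>i<n. \<Sum>j<n. ?q i j)" by (rule sum.swap)
  finally have "cnj ((K *\<^sub>v w) \<bullet>c w) = (K *\<^sub>v w) \<bullet>c w"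
    unfolding quadratic_form_sum[OF K(1) w] .
  from arg_cong[OF this, of Im] show ?thesis by simp
qed

text \<open>A positive semidefinite matrix is controlled by its diagonal, whose entries are
  nonnegative with sum at most \<open>snr\<close>. Off-diagonal entries are reached by test vectors
  supported on \<open>u\<close> and \<open>v\<close>.\<close>

lemma admissible_cov_norm_le:
  assumes "admissible_cov n snr K" "u < n" "v < n"
  shows "norm (K $$ (u, v)) \<le> snr"
proof -
  have K: "K \<in> carrier_mat n n" "mat_adjoint K = K"
    and psd: "\<And>w. w \<in> carrier_vec n \<Longrightarrow> 0 \<le> Re ((K *\<^sub>v w) \<bullet>c w)"
    and tr: "Re (mat_trace K) \<le> snr"
    using assms(1) by (auto simp: admissible_cov_def)
  have herm: "cnj (K $$ (i, j)) = K $$ (j, i)" if "i < n" "j < n" for i j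
    using mat_adjoint_index[OF K(1), of j i] K(2) that by simp
  have trace: "Re (mat_trace K) = (\<Sum>i<n. Re (K $$ (i, i)))"
    using K(1) by (simp add: mat_trace_def)
  have supp: "(K *\<^sub>v w) \<bullet>c w = (\<Sum>i\<in>S. \<Sum>j\<in>S. K $$ (i, j) * vec_index w j * cnj (vec_index w i))"
    if "w \<in> carrier_vec n" "S \<subseteq> {..<n}" "\<And>i. i < n \<Longrightarrow> i \<notin> S \<Longrightarrow> vec_index w i = 0" for w S
  proof -
    have "(\<Sum>i<n. \<Sum>j<n. K $$ (i, j) * vec_index w j * cnj (vec_index w i))
        = (\<Sum>i\<in>S. \<Sum>j<n. K $$ (i, j) * vec_index w j * cnj (vec_index w i))"
      using that by (intro sum.mono_neutral_right) auto
    also have "\<dots> = (\<Sum>i\<in>S. \<Sum>j\<in>S. K $$ (i, j) * vec_index w j * cnj (vec_index w i))"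
      using that by (intro sum.cong refl sum.mono_neutral_right) auto
    finally show ?thesis using quadratic_form_sum[OF K(1) that(1)] by simp
  qed
  have diag: "0 \<le> Re (K $$ (i, i))" if "i < n" for i
  proof -
    let ?w = "Matrix.vec n (\<lambda>l. if l = i then 1 else 0) :: complex Matrix.vec"
    have "(K *\<^sub>v ?w) \<bullet>c ?w = K $$ (i, i)"
      by (subst supp[where S="{i}"]) (use that in auto)
    then show ?thesis using psd[of ?w] by simp
  qed
  have diag_le: "Re (K $$ (i, i)) \<le> snr" if "i < n" for i
    using member_le_sum[of i "{..<n}" "\<lambda>i. Re (K $$ (i, i))"] that diag tr trace by auto
  show ?thesis
  proof (cases "K $$ (u, v) = 0 \<or> u = v")
    case True
    then show ?thesis
    proof
      assume "K $$ (u, v) = 0"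
      then show ?thesis using diag[OF assms(2)] diag_le[OF assms(2)] by simp
    next
      assume "u = v"
      have "K $$ (u, u) = of_real (Re (K $$ (u, u)))"
        using herm[of u u] assms by (metis Reals_cnj_iff of_real_Re)
      then have "norm (K $$ (u, u)) = \<bar>Re (K $$ (u, u))\<bar>" by (metis norm_of_real)
      then show ?thesis using \<open>u = v\<close> diag[OF assms(2)] diag_le[OF assms(2)] by simp
    qed
  next
    case False
    define z where "z = K $$ (u, v)"
    \<comment> \<open>A unit phase that turns both cross terms of the quadratic form into
      \<open>- norm z\<close>, so that \<open>2 * norm z\<close> is at most the sum of two diagonal
      entries.\<close>
    define b where "b = - cnj z / of_real (norm z)"
    have "z \<noteq> 0" using False by (simp add: z_def)
    have zz: "z * cnj z = of_real (norm z) * of_real (norm z)"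
      by (simp add: complex_norm_square[symmetric] power2_eq_square[symmetric])
    have zb: "z * b = - of_real (norm z)"
      unfolding b_def using zz \<open>z \<noteq> 0\<close> by simp
    have zb': "cnj z * cnj b = - of_real (norm z)"
      by (metis zb complex_cnj_mult complex_cnj_minus complex_cnj_complex_of_real)
    have bb: "b * cnj b = 1"
      unfolding b_def using zz \<open>z \<noteq> 0\<close> by (simp add: mult.commute)
    let ?w = "Matrix.vec n (\<lambda>l. if l = u then 1 else if l = v then b else 0) :: complex Matrix.vec"
    have "(K *\<^sub>v ?w) \<bullet>c ?w = K $$ (u, u) + z * b + (cnj z * cnj b + K $$ (v, v) * (b * cnj b))"
      by (subst supp[where S="{u, v}"]) (use assms False herm[of u v] in \<open>auto simp: z_def\<close>)
    also have "\<dots> = K $$ (u, u) + K $$ (v, v) - 2 * of_real (norm z)"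
      using zb zb' by (simp add: bb)
    finally have "0 \<le> Re (K $$ (u, u)) + Re (K $$ (v, v)) - 2 * norm z"
      using psd[of ?w] by simp
    then show ?thesis
      using diag_le[OF assms(2)] diag_le[OF assms(3)] by (simp add: z_def)
  qed
qed

text \<open>For an eigenvector \<open>v\<close> and \<open>w = mat_adjoint Hb *\<^sub>v v\<close>
  the eigenvalue is 1 plus the quotient of \<open>(K *\<^sub>v w) \<bullet>c w\<close> by
  \<open>v \<bullet>c v\<close>, hence at least 1, and the determinant is the product of the
  eigenvalues. This makes outage impossible at \<open>r = 0\<close>.\<close>

lemma mimo_rate_nonneg:
  assumes Hb: "Hb \<in> carrier_mat n m" and "admissible_cov m snr K"
  shows "mimo_rate Hb K \<ge> 0"
proof -
  have K: "K \<in> carrier_mat m m" "mat_adjoint K = K"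
    and psd: "\<And>w. w \<in> carrier_vec m \<Longrightarrow> 0 \<le> Re ((K *\<^sub>v w) \<bullet>c w)"
    using assms(2) by (auto simp: admissible_cov_def)
  note Ha = mat_adjoint_carrier[OF Hb]
  define X where "X = 1\<^sub>m n + Hb * K * mat_adjoint Hb"
  have X: "X \<in> carrier_mat n n" using Hb K Ha by (auto simp: X_def)
  have ev: "Im a = 0 \<and> Re a \<ge> 1" if e: "eigenvalue X a" for a
  proof -
    obtain v where v: "v \<in> carrier_vec n" "v \<noteq> 0\<^sub>v n" "X *\<^sub>v v = a \<cdot>\<^sub>v v"
      using e X by (auto simp: eigenvalue_def eigenvector_def)
    define w where "w = mat_adjoint Hb *\<^sub>v v"
    have w: "w \<in> carrier_vec m" using Ha v by (simp add: w_def)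
    define q where "q = (K *\<^sub>v w) \<bullet>c w"
    have Kw: "K *\<^sub>v w \<in> carrier_vec m" using K w by simp
    have "(Hb * K * mat_adjoint Hb) *\<^sub>v v = Hb *\<^sub>v (K *\<^sub>v w)"
      using Hb K Ha v w by (simp add: w_def assoc_mult_mat_vec[of _ n m _ m] assoc_mult_mat_vec[of _ n m _ n])
    then have Xv: "X *\<^sub>v v = v + Hb *\<^sub>v (K *\<^sub>v w)"
      using Hb K Ha v w by (simp add: X_def add_mult_distrib_mat_vec[of _ n n])
    have "(Hb *\<^sub>v (K *\<^sub>v w)) \<bullet>c v = q"
      unfolding q_def w_def by (rule cscalar_prod_mat_adjoint[OF Hb _ v(1)]) (use Kw w_def in simp)
    then have "(X *\<^sub>v v) \<bullet>c v = v \<bullet>c v + q"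
      using v(1) Hb Kw by (simp add: Xv add_scalar_prod_distrib[of _ n])
    then have eq: "a * (v \<bullet>c v) = v \<bullet>c v + q" using v by simp
    have "v \<bullet>c v \<noteq> 0" "v \<bullet>c v \<ge> 0" using v by auto
    then obtain x where x: "v \<bullet>c v = of_real x" "x > 0"
      by (metis complex_is_Real_iff less_eq_complex_def of_real_0 of_real_Re order_le_less zero_complex.sel(1) zero_complex.sel(2))
    have "Im q = 0" unfolding q_def by (rule hermitian_quadratic_form_real[OF K w])
    then obtain y where y: "q = of_real y" "y \<ge> 0"
      using psd[OF w] by (metis complex_is_Real_iff of_real_Re q_def)
    have "a = of_real (1 + y / x)"
      using eq x y by (simp add: field_simps)
    then show ?thesis using x y by simp
  qed
  obtain as where as: "char_poly X = (\<Prod>a\<leftarrow>as. [:- a, 1:])" "length as = n"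
    using char_poly_factorized[OF X] by blast
  have root: "Im a = 0 \<and> Re a \<ge> 1" if "a \<in> set as" for a
    using ev[of a] that unfolding eigenvalue_root_char_poly[OF X] as(1)
    by (auto simp: poly_prod_list prod_list_zero_iff)
  \<comment> \<open>At 0 the characteristic polynomial is the determinant up to the sign
    \<open>(- 1) ^ n\<close>, and the product of its roots up to the same sign.\<close>
  have "poly (char_poly X) 0 = Determinant.det (- X)"
  proof -
    have "X + 0 \<cdot>\<^sub>m 1\<^sub>m n = X" by (rule eq_matI) (use X in auto)
    then show ?thesis using X by (simp add: char_poly_matrix[OF X] char_matrix_def)
  qed
  moreover have "Determinant.det (- X) = (- 1) ^ n * Determinant.det X"
  proof -
    have "- X = (- 1) \<cdot>\<^sub>m X" by (rule eq_matI) auto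
    then show ?thesis using X det_smult[of "-1" X] by simp
  qed
  moreover have "poly (char_poly X) 0 = (- 1) ^ n * prod_list as"
  proof -
    have "poly (\<Prod>a\<leftarrow>bs. [:- a, 1:]) 0 = (- 1) ^ length bs * prod_list bs" for bs :: "complex list"
      by (induction bs) auto
    then show ?thesis by (simp add: as)
  qed
  ultimately have "Determinant.det X = prod_list as" by simp
  moreover have "Im (prod_list bs) = 0 \<and> Re (prod_list bs) \<ge> 1" if "set bs \<subseteq> set as" for bs
    using that
  proof (induction bs)
    case (Cons b bs)
    then show ?case
      using root[of b] mult_mono[of 1 "Re b" 1 "Re (prod_list bs)"] by simp
  qed simp
  ultimately have "Re (Determinant.det X) \<ge> 1" by auto
  moreover have "dim_row Hb = n" using Hb by simp
  ultimately show ?thesis by (simp add: mimo_rate_def X_def)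
qed

lemma norm_sum_le_card:
  assumes "\<And>i. i < n \<Longrightarrow> norm (f i :: complex) \<le> b"
  shows "norm (\<Sum>i<n. f i) \<le> real n * b"
  using sum_norm_le[of "{..<n}" f "\<lambda>_. b"] assms by simp

lemma sum_mult_factorized:
  fixes f :: "'p \<Rightarrow> 'a :: comm_ring_1" and g :: "'p \<Rightarrow> 'u \<Rightarrow> 'a" and h :: "'q \<Rightarrow> 'u \<Rightarrow> 'a" and k :: "'q \<Rightarrow> 'a"
  shows "(\<Sum>u\<in>U. (\<Sum>p\<in>P. f p * g p u) * (\<Sum>q\<in>Q. h q u * k q))
    = (\<Sum>p\<in>P. \<Sum>q\<in>Q. f p * (\<Sum>u\<in>U. g p u * h q u) * k q)"
proof -
  have "(\<Sum>u\<in>U. (\<Sum>p\<in>P. f p * g p u) * (\<Sum>q\<in>Q. h q u * k q))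
      = (\<Sum>u\<in>U. \<Sum>p\<in>P. \<Sum>q\<in>Q. f p * (g p u * h q u) * k q)"
    by (simp only: sum_product mult.assoc)
  also have "\<dots> = (\<Sum>p\<in>P. \<Sum>u\<in>U. \<Sum>q\<in>Q. f p * (g p u * h q u) * k q)"
    by (rule sum.swap)
  also have "\<dots> = (\<Sum>p\<in>P. \<Sum>q\<in>Q. \<Sum>u\<in>U. f p * (g p u * h q u) * k q)"
    by (intro sum.cong refl) (rule sum.swap)
  finally show ?thesis
    by (simp only: sum_distrib_left sum_distrib_right)
qed

lemma norm_det_one_plus_mat_le:
  fixes \<alpha> \<beta> :: "nat \<Rightarrow> nat \<Rightarrow> complex"
  assumes "a \<ge> 1" "b \<ge> 1" "\<kappa> \<ge> 1" "\<And>p. y p \<ge> 0" "antimono y"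
    "\<And>i p. i < n \<Longrightarrow> p < m \<Longrightarrow> norm (\<alpha> i p) \<le> a"
    "\<And>p q. p < m \<Longrightarrow> q < m \<Longrightarrow> norm (k p q) \<le> \<kappa>"
    "\<And>j q. j < n \<Longrightarrow> q < m \<Longrightarrow> norm (\<beta> j q) \<le> b"
    and X: "X \<in> carrier_mat n n"
    and Xij: "\<And>i j. i < n \<Longrightarrow> j < n \<Longrightarrow>
      X $$ (i, j) = (\<Sum>p<m. \<Sum>q<m. \<alpha> i p * of_real (y p) * (k p q * of_real (y q) * \<beta> j q))"
  shows "norm (Determinant.det (1\<^sub>m n + X))
    \<le> real (n + m) ^ (2 * n) * ((a * \<kappa> * b) ^ n * fact n) * (\<Prod>p<n. max 1 (y p))\<^sup>2"
proof -
  have "1\<^sub>m n + X = Matrix.mat n n (\<lambda>(i, j). (if i = j then 1 else 0) +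
      (\<Sum>p<m. \<Sum>q<m. \<alpha> i p * of_real (y p) * (k p q * of_real (y q) * \<beta> j q)))"
    by (rule eq_matI) (use X Xij in auto)
  then show ?thesis
    using norm_det_one_plus_le[OF assms(1-8)] by simp
qed

text \<open>The entries of \<open>K / snr\<close> have norm at most 1, so \<open>snr\<close> can be
  shared as a factor \<open>sqrt snr\<close> for each of the two copies of \<open>s\<close>. The
  number of factors has to be the smaller dimension; for \<open>nt < nr\<close> the matrices are
  therefore swapped first. \<open>C\<close> depends only on the dimensions and on \<open>ca\<close>
  and \<open>cb\<close>, which makes the bound uniform in channel and covariance.\<close>

lemma norm_det_rate_le:
  obtains C where "C > 0"
    "\<And>Hb K a b s snr. \<lbrakk>Hb \<in> carrier_mat nr nt; admissible_cov nt snr K; snr > 0;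
       \<And>p. s p \<ge> (0::real); antimono s;
       \<And>q i. q < m \<Longrightarrow> i < nr \<Longrightarrow> norm (a q i) \<le> ca; \<And>q j. q < m \<Longrightarrow> j < nt \<Longrightarrow> norm (b q j) \<le> cb;
       \<And>i j. i < nr \<Longrightarrow> j < nt \<Longrightarrow> Hb $$ (i, j) = (\<Sum>q<m. of_real (s q) * a q i * b q j)\<rbrakk>
     \<Longrightarrow> norm (Determinant.det (1\<^sub>m nr + Hb * K * mat_adjoint Hb))
       \<le> C * (\<Prod>p<min nr nt. max 1 (sqrt snr * s p))\<^sup>2"
proof -
  define A where "A = max 1 ca"
  define B where "B = max 1 cb"
  define B2 where "B2 = max 1 (real nt * B)"
  define k1 where "k1 = max 1 (real nt * (B * B2))"
  define k2 where "k2 = max 1 (real nr * (A * A))"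
  define C where "C = (if nr \<le> nt then real (nr + m) ^ (2 * nr) * ((A * k1 * A) ^ nr * fact nr)
     else real (nt + m) ^ (2 * nt) * ((B2 * k2 * B) ^ nt * fact nt))"
  have pos: "A \<ge> 1" "B \<ge> 1" "k1 \<ge> 1" "k2 \<ge> 1" "B2 \<ge> 1"
    by (auto simp: A_def B_def k1_def k2_def B2_def)
  show ?thesis
  proof (rule that[of "max 1 C"])
    fix Hb K :: "complex mat" and a b :: "nat \<Rightarrow> nat \<Rightarrow> complex" and s :: "nat \<Rightarrow> real" and snr :: real
    assume Hb: "Hb \<in> carrier_mat nr nt" and adm: "admissible_cov nt snr K" and snr: "snr > 0"
      and s: "\<And>p. s p \<ge> 0" "antimono s"
      and a': "\<And>q i. q < m \<Longrightarrow> i < nr \<Longrightarrow> norm (a q i) \<le> ca"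
      and b': "\<And>q j. q < m \<Longrightarrow> j < nt \<Longrightarrow> norm (b q j) \<le> cb"
      and fac: "\<And>i j. i < nr \<Longrightarrow> j < nt \<Longrightarrow> Hb $$ (i, j) = (\<Sum>q<m. of_real (s q) * a q i * b q j)"
    have a: "norm (a q i) \<le> A" if "q < m" "i < nr" for q i using a'[OF that] by (simp add: A_def)
    have b: "norm (b q i) \<le> B" if "q < m" "i < nt" for q i using b'[OF that] by (simp add: B_def)
    have K: "K \<in> carrier_mat nt nt" using adm by (simp add: admissible_cov_def)
    have Kle: "norm (K $$ (u, v) / of_real snr) \<le> 1" if "u < nt" "v < nt" for u v
      using admissible_cov_norm_le[OF adm that] snr by (simp add: norm_divide)
    note Ha = mat_adjoint_carrier[OF Hb]
    define y where "y = (\<lambda>p. sqrt snr * s p)"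
    have y: "\<And>p. y p \<ge> 0" "antimono y"
      using s snr by (auto simp: y_def antimono_def intro!: mult_left_mono)
    have yy: "of_real (y p) * of_real (y q) = (of_real snr * of_real (s p) * of_real (s q) :: complex)" for p q
    proof -
      have "y p * y q = (sqrt snr * sqrt snr) * s p * s q" by (simp add: y_def)
      also have "\<dots> = snr * s p * s q" using snr by simp
      finally show ?thesis by (metis of_real_mult)
    qed
    \<comment> \<open>The normalized covariance is absorbed into the transmit vectors of the
      conjugate factor of the channel.\<close>
    define c where "c = (\<lambda>q u. \<Sum>v<nt. K $$ (u, v) / of_real snr * cnj (b q v))"
    have c: "norm (c p u) \<le> B2" if "p < m" "u < nt" for u p
    proof -
      have "norm (K $$ (u, w) / of_real snr * cnj (b p w)) \<le> 1 * B" if "w < nt" for w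
        unfolding norm_mult complex_mod_cnj
        using Kle[OF \<open>u < nt\<close> that] b[OF \<open>p < m\<close> that] pos by (intro mult_mono) auto
      then have "norm (c p u) \<le> real nt * B"
        unfolding c_def by (intro norm_sum_le_card) auto
      then show ?thesis by (simp add: B2_def)
    qed
    define Z where "Z = K * mat_adjoint Hb"
    have Z: "Z \<in> carrier_mat nt nr" using K Ha by (simp add: Z_def)
    have Zuj: "Z $$ (u, j) = (\<Sum>q<m. c q u * (of_real snr * of_real (s q) * cnj (a q j)))"
      if "u < nt" "j < nr" for u j
    proof -
      have "Z $$ (u, j) = (\<Sum>v<nt. K $$ (u, v) * cnj (Hb $$ (j, v)))"
        unfolding Z_def using that by (simp add: mult_mat_index_sum[OF K Ha] mat_adjoint_index[OF Hb] del: index_mult_mat)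
      also have "\<dots> = (\<Sum>v<nt. \<Sum>q<m. K $$ (u, v) / of_real snr * cnj (b q v) * (of_real snr * of_real (s q) * cnj (a q j)))"
        using that snr by (intro sum.cong refl) (simp add: fac sum_distrib_left mult_ac)
      also have "\<dots> = (\<Sum>q<m. c q u * (of_real snr * of_real (s q) * cnj (a q j)))"
        unfolding c_def sum_distrib_right by (rule sum.swap)
      finally show ?thesis .
    qed
    have "norm (Determinant.det (1\<^sub>m nr + Hb * Z)) \<le> C * (\<Prod>p<min nr nt. max 1 (y p))\<^sup>2"
    proof (cases "nr \<le> nt")
      case True
      define \<kappa> where "\<kappa> = (\<lambda>p q. \<Sum>u<nt. b p u * c q u)"
      have "norm (\<kappa> p q) \<le> k1" if "p < m" "q < m" for p q
      proof -
        have "norm (b p u * c q u) \<le> B * B2" if "u < nt" for u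
          unfolding norm_mult using b[OF \<open>p < m\<close> that] c[OF \<open>q < m\<close> that] pos by (intro mult_mono) auto
        then have "norm (\<kappa> p q) \<le> real nt * (B * B2)"
          unfolding \<kappa>_def by (intro norm_sum_le_card) auto
        then show ?thesis by (simp add: k1_def)
      qed
      moreover have "(Hb * Z) $$ (i, j)
          = (\<Sum>p<m. \<Sum>q<m. a p i * of_real (y p) * (\<kappa> p q * of_real (y q) * cnj (a q j)))"
        if "i < nr" "j < nr" for i j
      proof -
        have "(Hb * Z) $$ (i, j) = (\<Sum>u<nt. (\<Sum>p<m. (of_real (s p) * a p i) * b p u) *
            (\<Sum>q<m. c q u * (of_real snr * of_real (s q) * cnj (a q j))))"
          using that by (simp add: mult_mat_index_sum[OF Hb Z] fac Zuj del: index_mult_mat)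
        also have "\<dots> = (\<Sum>p<m. \<Sum>q<m. (of_real (s p) * a p i) * \<kappa> p q * (of_real snr * of_real (s q) * cnj (a q j)))"
          unfolding sum_mult_factorized \<kappa>_def ..
        also have "\<dots> = (\<Sum>p<m. \<Sum>q<m. (of_real snr * of_real (s p) * of_real (s q)) * (a p i * \<kappa> p q * cnj (a q j)))"
          by (simp only: mult_ac)
        also have "\<dots> = (\<Sum>p<m. \<Sum>q<m. a p i * of_real (y p) * (\<kappa> p q * of_real (y q) * cnj (a q j)))"
          unfolding yy[symmetric] by (simp only: mult_ac)
        finally show ?thesis .
      qed
      ultimately show ?thesis
        using norm_det_one_plus_mat_le[of A A k1 y nr m "\<lambda>i p. a p i" \<kappa> "\<lambda>j q. cnj (a q j)" "Hb * Z"]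
          pos y a True Hb Z
        by (simp add: C_def min_def del: index_mult_mat)
    next
      case False
      define \<kappa> where "\<kappa> = (\<lambda>p q. \<Sum>i<nr. cnj (a p i) * a q i)"
      have "norm (\<kappa> p q) \<le> k2" if "p < m" "q < m" for p q
      proof -
        have "norm (cnj (a p i) * a q i) \<le> A * A" if "i < nr" for i
          unfolding norm_mult complex_mod_cnj
          using a[OF \<open>p < m\<close> that] a[OF \<open>q < m\<close> that] pos by (intro mult_mono) auto
        then have "norm (\<kappa> p q) \<le> real nr * (A * A)"
          unfolding \<kappa>_def by (intro norm_sum_le_card) auto
        then show ?thesis by (simp add: k2_def)
      qed
      moreover have "(Z * Hb) $$ (u, j)
          = (\<Sum>p<m. \<Sum>q<m. c p u * of_real (y p) * (\<kappa> p q * of_real (y q) * b q j))"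
        if "u < nt" "j < nt" for u j
      proof -
        have "(Z * Hb) $$ (u, j) = (\<Sum>i<nr. (\<Sum>p<m. (c p u * of_real snr * of_real (s p)) * cnj (a p i)) *
            (\<Sum>q<m. a q i * (of_real (s q) * b q j)))"
          using that by (simp add: mult_mat_index_sum[OF Z Hb] fac Zuj mult_ac del: index_mult_mat)
        also have "\<dots> = (\<Sum>p<m. \<Sum>q<m. (c p u * of_real snr * of_real (s p)) * \<kappa> p q * (of_real (s q) * b q j))"
          unfolding sum_mult_factorized \<kappa>_def ..
        also have "\<dots> = (\<Sum>p<m. \<Sum>q<m. (of_real snr * of_real (s p) * of_real (s q)) * (c p u * \<kappa> p q * b q j))"
          by (simp only: mult_ac)
        also have "\<dots> = (\<Sum>p<m. \<Sum>q<m. c p u * of_real (y p) * (\<kappa> p q * of_real (y q) * b q j))"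
          unfolding yy[symmetric] by (simp only: mult_ac)
        finally show ?thesis .
      qed
      ultimately show ?thesis
        using norm_det_one_plus_mat_le[of B2 B k2 y nt m "\<lambda>u p. c p u" \<kappa> "\<lambda>j q. b q j" "Z * Hb"]
          pos y b c False Hb Z
        by (simp add: C_def min_def det_one_plus_mult_commute[OF Hb Z] del: index_mult_mat)
    qed
    also have "\<dots> \<le> max 1 C * (\<Prod>p<min nr nt. max 1 (y p))\<^sup>2"
      by (intro mult_right_mono) auto
    finally show "norm (Determinant.det (1\<^sub>m nr + Hb * K * mat_adjoint Hb))
       \<le> max 1 C * (\<Prod>p<min nr nt. max 1 (sqrt snr * s p))\<^sup>2"
      using assoc_mult_mat[OF Hb K Ha] by (simp add: y_def Z_def)
  qed simp
qed

section \<open>Outage exponents\<close>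

lemma sum_max_shift_less:
  fixes g :: "nat \<Rightarrow> real"
  assumes "\<And>p. g p \<ge> 0" and "(\<Sum>p<n. g p) > 0" and "\<eta> > 0"
  shows "(\<Sum>p<n. max 0 (g p - \<eta>)) < (\<Sum>p<n. g p)"
proof -
  obtain p where "p < n" "g p > 0"
    using assms(2) sum_nonpos[of "{..<n}" g] by (force simp: not_less[symmetric])
  then show ?thesis
    using assms by (intro sum_strict_mono_ex1) (auto intro!: bexI[of _ p])
qed

text \<open>The \<open>p\<close>-th singular value has size \<open>snr powr (- (e p + \<eta>) / 2)\<close>. The extra decay \<open>\<eta>\<close> makes the
  rate strictly smaller than \<open>r * ln snr\<close>, also when \<open>r\<close> is an integer.\<close>
lemma diversity_le_of_exponents:
  fixes e :: "nat \<Rightarrow> real" and Pout :: "real \<Rightarrow> real"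
  assumes "c > 0" "C > 0"
    and outage: "\<And>snr s. snr > 1 \<Longrightarrow> (\<And>p. 0 < s p) \<Longrightarrow> (\<And>p. s p \<le> 1) \<Longrightarrow> antimono s \<Longrightarrow>
      C * (\<Prod>p<n. max 1 (sqrt snr * s p))\<^sup>2 < snr powr r \<Longrightarrow>
      c * (\<Prod>i<Nr. \<Prod>j<Nt. (s (min i j))\<^sup>2) \<le> Pout snr"
    and lim: "((\<lambda>snr. ln (Pout snr) / ln snr) \<longlongrightarrow> - d) at_top"
    and e: "mono e" "\<And>p. 0 \<le> e p" "\<And>p. e p \<le> 1"
    and r: "(\<Sum>p<n. 1 - e p) = r" "r > 0"
  shows "d \<le> (\<Sum>i<Nr. \<Sum>j<Nt. e (min i j))"
proof -
  define D where "D = (\<Sum>i<Nr. \<Sum>j<Nt. e (min i j))"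
  \<comment> \<open>The shift costs \<eta> for each of the \<open>Nr * Nt\<close> entries; this loss
    disappears at the end as \<eta> tends to 0.\<close>
  have main: "d \<le> D + \<eta> * (real Nr * real Nt)" if "\<eta> > 0" for \<eta>
  proof -
    define f where "f = (\<lambda>p. e p + \<eta>)"
    define D' where "D' = (\<Sum>i<Nr. \<Sum>j<Nt. f (min i j))"
    define \<mu> where "\<mu> = (\<Sum>p<n. max 0 (1 - f p))"
    have D': "D' = D + \<eta> * (real Nr * real Nt)"
      by (simp add: D'_def D_def f_def sum.distrib)
    have "\<mu> < r"
      using sum_max_shift_less[of "\<lambda>p. 1 - e p" n \<eta>] e r that
      by (simp add: \<mu>_def f_def algebra_simps)
    \<comment> \<open>The strict gap between \<mu> and \<open>r\<close> absorbs the constant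
      \<open>C\<close> for large \<open>snr\<close>.\<close>
    have "filterlim (\<lambda>snr::real. snr powr (r - \<mu>)) at_top at_top"
      using \<open>\<mu> < r\<close> by real_asymp
    then have "eventually (\<lambda>snr. C < snr powr (r - \<mu>)) at_top"
      by (simp add: filterlim_at_top_dense)
    then have ev: "eventually (\<lambda>snr. ln c / ln snr - D' \<le> ln (Pout snr) / ln snr) at_top"
      using eventually_gt_at_top[of 1]
    proof eventually_elim
      case (elim snr)
      define s where "s = (\<lambda>p. snr powr (- f p / 2))"
      have f0: "f p \<ge> 0" for p using e(2)[of p] that by (simp add: f_def)
      have s: "0 < s p" "s p \<le> 1" for p
        using elim f0[of p] powr_mono[of "- f p / 2" 0 snr] by (auto simp: s_def)
      have "antimono s"
        using elim e(1) by (auto simp: antimono_def mono_def s_def f_def intro!: powr_mono)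
      have "max 1 (sqrt snr * s p) = snr powr (max 0 (1 - f p) / 2)" for p
      proof -
        have "sqrt snr * s p = snr powr ((1 - f p) / 2)"
          using elim by (simp add: s_def powr_half_sqrt[symmetric] powr_add[symmetric] diff_divide_distrib)
        moreover have "max 1 (snr powr x) = snr powr (max 0 x)" for x
          using elim powr_mono[of 0 x snr] powr_mono[of x 0 snr] by (auto simp: max_def)
        moreover have "max 0 ((1 - f p) / 2) = max 0 (1 - f p) / 2" by (simp add: max_def)
        ultimately show ?thesis by (simp only:)
      qed
      then have "(\<Prod>p<n. max 1 (sqrt snr * s p))\<^sup>2 = (\<Prod>p<n. snr powr (max 0 (1 - f p)))"
        using elim by (simp add: prod_power_distrib powr_power)
      also have "\<dots> = snr powr \<mu>"
        using elim by (simp add: \<mu>_def powr_sum)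
      finally have "C * (\<Prod>p<n. max 1 (sqrt snr * s p))\<^sup>2 = C * snr powr \<mu>" by simp
      also have "\<dots> < snr powr (r - \<mu>) * snr powr \<mu>"
        using elim by (intro mult_strict_right_mono) auto
      also have "\<dots> = snr powr r" by (simp add: powr_add[symmetric])
      finally have "c * (\<Prod>i<Nr. \<Prod>j<Nt. (s (min i j))\<^sup>2) \<le> Pout snr"
        using outage[of snr s] s \<open>antimono s\<close> elim by blast
      moreover have "(\<Prod>i<Nr. \<Prod>j<Nt. (s (min i j))\<^sup>2) = snr powr (- D')"
      proof -
        have "(s p)\<^sup>2 = snr powr (- f p)" for p
          using elim by (simp add: s_def powr_power)
        then show ?thesis using elim by (simp add: D'_def powr_sum[symmetric] sum_negf[symmetric])
      qed
      ultimately have "c * snr powr (- D') \<le> Pout snr" by simp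
      \<comment> \<open>Positivity excludes \<open>Pout snr = 0\<close>, where \<open>ln\<close>
        takes the default value 0 and monotonicity would fail.\<close>
      moreover have "c * snr powr (- D') > 0" using elim \<open>c > 0\<close> by simp
      ultimately have "ln (c * snr powr (- D')) \<le> ln (Pout snr)"
        by (subst ln_le_cancel_iff) linarith+
      moreover have "ln (c * snr powr (- D')) = ln c - D' * ln snr"
        using elim \<open>c > 0\<close> by (simp add: ln_mult ln_powr)
      ultimately have "(ln c - D' * ln snr) / ln snr \<le> ln (Pout snr) / ln snr"
        using elim by (intro divide_right_mono) auto
      then show ?case using elim by (simp add: diff_divide_distrib)
    qed
    have "((\<lambda>snr. ln c / ln snr - D') \<longlongrightarrow> 0 - D') at_top"
      by (intro tendsto_intros tendsto_divide_0[OF tendsto_const] filterlim_at_top_imp_at_infinity ln_at_top)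
    from tendsto_le[OF _ lim this ev] show ?thesis by (simp add: D')
  qed
  show ?thesis
  proof (rule field_le_epsilon)
    fix \<epsilon> :: real assume "\<epsilon> > 0"
    define \<eta> where "\<eta> = \<epsilon> / (real Nr * real Nt + 1)"
    have pos: "real Nr * real Nt + 1 > 0" by (simp add: add_nonneg_pos)
    have "\<eta> > 0" using \<open>\<epsilon> > 0\<close> pos by (simp add: \<eta>_def)
    have "\<eta> * (real Nr * real Nt) \<le> \<eta> * (real Nr * real Nt + 1)"
      using \<open>\<eta> > 0\<close> by simp
    also have "\<dots> = \<epsilon>" using pos by (simp add: \<eta>_def)
    finally show "d \<le> (\<Sum>i<Nr. \<Sum>j<Nt. e (min i j)) + \<epsilon>"
      using main[OF \<open>\<eta> > 0\<close>] by (simp add: D_def)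
  qed
qed

section \<open>Cost and rate of two-level exponents\<close>

text \<open>The condition splits into \<open>k \<le> i\<close> and \<open>k \<le> j\<close>, so the
  double sum factors. This is where the corner points of the outer bound come from.\<close>

lemma sum_threshold_min:
  assumes "k \<le> Nr" "k \<le> Nt"
  shows "(\<Sum>i<Nr. \<Sum>j<Nt. if k \<le> min i j then 1 else (0::real)) = dmt_pt Nr Nt k"
proof -
  have *: "(\<Sum>i<N. if k \<le> i then 1 else (0::real)) = real N - real k" if "k \<le> N" for N
  proof -
    have "(\<Sum>i<N. if k \<le> i then 1 else (0::real)) = (\<Sum>i\<in>{k..<N}. 1)"
      by (rule sum.mono_neutral_cong_right) auto
    then show ?thesis using that by simp
  qed
  have "(\<Sum>i<Nr. \<Sum>j<Nt. if k \<le> min i j then 1 else (0::real))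
      = (\<Sum>i<Nr. \<Sum>j<Nt. (if k \<le> i then 1 else 0) * (if k \<le> j then 1 else 0))"
    by (intro sum.cong refl) auto
  also have "\<dots> = (\<Sum>i<Nr. if k \<le> i then 1 else 0) * (\<Sum>j<Nt. if k \<le> j then 1 else 0)"
    by (simp only: sum_product)
  finally show ?thesis using assms by (simp only: * dmt_pt_def)
qed

text \<open>Here \<open>e\<close> is 0 below \<open>k\<close>, \<alpha> at \<open>k\<close> and
  \<beta> above, written as a combination of two threshold functions. With \<beta> = 1, varying
  \<alpha> moves along the segment between two consecutive corner values.\<close>

lemma sum_two_level_exponents:
  assumes "k < Nr" "k < Nt" and e: "e = (\<lambda>p. \<alpha> * (if k \<le> p then 1 else 0) + (\<beta> - \<alpha>) * (if Suc k \<le> p then 1 else 0))"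
  shows "(\<Sum>i<Nr. \<Sum>j<Nt. e (min i j)) = \<alpha> * dmt_pt Nr Nt k + (\<beta> - \<alpha>) * dmt_pt Nr Nt (Suc k)"
proof -
  have "(\<Sum>i<Nr. \<Sum>j<Nt. e (min i j)) = \<alpha> * (\<Sum>i<Nr. \<Sum>j<Nt. if k \<le> min i j then 1 else (0::real))
      + (\<beta> - \<alpha>) * (\<Sum>i<Nr. \<Sum>j<Nt. if Suc k \<le> min i j then 1 else (0::real))"
    unfolding e by (simp only: sum.distrib sum_distrib_left)
  then show ?thesis using assms by (simp only: sum_threshold_min less_imp_le Suc_leI)
qed

lemma sum_two_level_rate:
  fixes \<alpha> \<beta> :: real
  assumes "k < n" and e: "e = (\<lambda>p. \<alpha> * (if k \<le> p then 1 else 0) + (\<beta> - \<alpha>) * (if Suc k \<le> p then 1 else 0))"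
  shows "(\<Sum>p<n. 1 - e p) = real k + (1 - \<alpha>) + (real n - real k - 1) * (1 - \<beta>)"
proof -
  have "(\<Sum>p<n. 1 - e p) = (\<Sum>p\<in>{..<k}. 1 - e p) + (1 - e k) + (\<Sum>p\<in>{Suc k..<n}. 1 - e p)"
  proof -
    have "{..<n} = insert k ({..<k} \<union> {Suc k..<n})" using assms by auto
    moreover have "(\<Sum>p\<in>{..<k} \<union> {Suc k..<n}. 1 - e p) = (\<Sum>p<k. 1 - e p) + (\<Sum>p\<in>{Suc k..<n}. 1 - e p)"
      by (rule sum.union_disjoint) auto
    ultimately show ?thesis by simp
  qed
  then show ?thesis using assms by (simp add: e algebra_simps of_nat_diff)
qed

lemma norm_bounded_on_grid:
  fixes A :: "nat \<Rightarrow> nat \<Rightarrow> complex"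
  obtains c where "c \<ge> 0" "\<And>x k. x < n \<Longrightarrow> k < m \<Longrightarrow> norm (A x k) \<le> c"
proof -
  have "bounded ((\<lambda>(x, k). A x k) ` ({..<n} \<times> {..<m}))" by (intro finite_imp_bounded) auto
  then obtain c where c: "\<forall>z\<in>(\<lambda>(x, k). A x k) ` ({..<n} \<times> {..<m}). norm z \<le> c"
    unfolding bounded_iff by blast
  have "norm (A x k) \<le> max 0 c" if "x < n" "k < m" for x k
  proof -
    have "norm (A x k) \<le> c" using c that by auto
    then show ?thesis by simp
  qed
  then show ?thesis using that[of "max 0 c"] by simp
qed

section \<open>Outage probability of an arbitrary selection scheme\<close>

text \<open>The coefficients are bounded for all \<open>x\<close> and \<open>y\<close> at once,
  hence for any ports picked later.\<close>

lemma channel_entries: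
  assumes "Urx \<in> carrier_mat Nr Nr" "Utx \<in> carrier_mat Nt Nt"
  obtains cA cB A B where "cA \<ge> 0" "cB \<ge> 0"
    "\<And>x k. x < Nr \<Longrightarrow> k < Nr \<Longrightarrow> norm (A x k) \<le> cA" "\<And>l y. l < Nt \<Longrightarrow> y < Nt \<Longrightarrow> norm (B l y) \<le> cB"
    "\<And>G x y. G \<in> carrier_mat Nr Nt \<Longrightarrow> x < Nr \<Longrightarrow> y < Nt \<Longrightarrow>
      channel \<delta> Nr Urx lrx Nt Utx ltx G $$ (x, y) = (\<Sum>k<Nr. \<Sum>l<Nt. A x k * G $$ (k, l) * B l y)"
proof -
  define P where "P = Urx * sqrt_diag Nr lrx"
  define Q where "Q = mat_adjoint (sqrt_diag Nt ltx) * mat_adjoint Utx"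
  have S: "sqrt_diag n l \<in> carrier_mat n n" for n l by (simp add: sqrt_diag_def diag_cmat_def)
  have P: "P \<in> carrier_mat Nr Nr" using assms S by (simp add: P_def)
  have Q: "Q \<in> carrier_mat Nt Nt" unfolding Q_def
    by (rule mult_carrier_mat[OF mat_adjoint_carrier[OF S] mat_adjoint_carrier[OF assms(2)]])
  define A where "A = (\<lambda>x k. of_real \<delta> * P $$ (x, k))"
  define B where "B = (\<lambda>l y. Q $$ (l, y))"
  have entry: "channel \<delta> Nr Urx lrx Nt Utx ltx G $$ (x, y) = (\<Sum>k<Nr. \<Sum>l<Nt. A x k * G $$ (k, l) * B l y)"
    if G: "G \<in> carrier_mat Nr Nt" and xy: "x < Nr" "y < Nt" for G x y
  proof -
    have PG: "P * G \<in> carrier_mat Nr Nt" using P G by simp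
    have "P * G * mat_adjoint (sqrt_diag Nt ltx) * mat_adjoint Utx = P * G * Q"
      unfolding Q_def by (rule assoc_mult_mat[OF PG mat_adjoint_carrier[OF S] mat_adjoint_carrier[OF assms(2)]])
    then have "channel \<delta> Nr Urx lrx Nt Utx ltx G = complex_of_real \<delta> \<cdot>\<^sub>m (P * G * Q)"
      unfolding channel_def P_def by simp
    then have "channel \<delta> Nr Urx lrx Nt Utx ltx G $$ (x, y) = of_real \<delta> * (P * G * Q) $$ (x, y)"
      using xy P PG Q by (simp del: index_mult_mat(1))
    also have "(P * G * Q) $$ (x, y) = (\<Sum>l<Nt. (\<Sum>k<Nr. P $$ (x, k) * G $$ (k, l)) * Q $$ (l, y))"
      using xy by (simp add: mult_mat_index_sum[OF PG Q] mult_mat_index_sum[OF P G] del: index_mult_mat)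
    also have "of_real \<delta> * \<dots> = (\<Sum>l<Nt. \<Sum>k<Nr. A x k * G $$ (k, l) * B l y)"
      unfolding A_def B_def sum_distrib_left sum_distrib_right by (simp only: mult_ac)
    also have "\<dots> = (\<Sum>k<Nr. \<Sum>l<Nt. A x k * G $$ (k, l) * B l y)" by (rule sum.swap)
    finally show ?thesis .
  qed
  obtain cA where cA: "cA \<ge> 0" "\<And>x k. x < Nr \<Longrightarrow> k < Nr \<Longrightarrow> norm (A x k) \<le> cA"
    using norm_bounded_on_grid[of Nr Nr A] by blast
  obtain cB where cB: "cB \<ge> 0" "\<And>x k. x < Nt \<Longrightarrow> k < Nt \<Longrightarrow> norm (B x k) \<le> cB"
    using norm_bounded_on_grid[of Nt Nt B] by blast
  show ?thesis by (rule that[OF cA(1) cB(1) cA(2) cB(2) entry])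
qed

lemma selection_entry:
  assumes H: "H \<in> carrier_mat Nr Nt" and "i < nr" "j < nt" "p i < Nr" "q j < Nt"
  shows "(sel_mat nr Nr p * H * transpose_mat (sel_mat nt Nt q)) $$ (i, j) = H $$ (p i, q j)"
proof -
  have S: "sel_mat n N p \<in> carrier_mat n N" for n N p by (simp add: sel_mat_def)
  have SH: "sel_mat nr Nr p * H \<in> carrier_mat nr Nt" by (rule mult_carrier_mat[OF S H])
  have T: "transpose_mat (sel_mat nt Nt q) \<in> carrier_mat Nt nt" by (simp add: sel_mat_def)
  have T_entry: "transpose_mat (sel_mat nt Nt q) $$ (l, j) = (if l = q j then 1 else 0)" if "l < Nt" for l
    using that assms by (simp add: sel_mat_def)
  have 1: "(sel_mat nr Nr p * H) $$ (i, l) = H $$ (p i, l)" if "l < Nt" for l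
  proof -
    have "(sel_mat nr Nr p * H) $$ (i, l) = (\<Sum>k<Nr. if k = p i then H $$ (k, l) else 0)"
      unfolding mult_mat_index_sum[OF S H assms(2) that]
      by (rule sum.cong[OF refl]) (use assms in \<open>auto simp: sel_mat_def\<close>)
    then show ?thesis using assms by simp
  qed
  have "(sel_mat nr Nr p * H * transpose_mat (sel_mat nt Nt q)) $$ (i, j)
      = (\<Sum>l<Nt. if l = q j then H $$ (p i, l) else 0)"
    unfolding mult_mat_index_sum[OF SH T assms(2,3)]
    by (rule sum.cong[OF refl]) (auto simp: 1 T_entry simp del: index_mult_mat(1) index_transpose_mat(1))
  then show ?thesis using assms by simp
qed

lemma sum_bilinear_factorization:
  fixes f g :: "nat \<Rightarrow> complex"
  shows "(\<Sum>k<n. \<Sum>l<m. f k * (\<Sum>q<t. s q * a q k * b q l) * g l)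
    = (\<Sum>q<t. s q * (\<Sum>k<n. f k * a q k) * (\<Sum>l<m. b q l * g l))"
proof -
  have "(\<Sum>k<n. \<Sum>l<m. f k * (\<Sum>q<t. s q * a q k * b q l) * g l)
      = (\<Sum>k<n. \<Sum>l<m. \<Sum>q<t. s q * ((f k * a q k) * (b q l * g l)))"
    unfolding sum_distrib_left sum_distrib_right by (simp only: mult_ac)
  also have "\<dots> = (\<Sum>k<n. \<Sum>q<t. \<Sum>l<m. s q * ((f k * a q k) * (b q l * g l)))"
    by (intro sum.cong refl) (rule sum.swap)
  also have "\<dots> = (\<Sum>q<t. \<Sum>k<n. \<Sum>l<m. s q * ((f k * a q k) * (b q l * g l)))"
    by (rule sum.swap)
  finally show ?thesis
    unfolding mult.assoc[of _ "\<Sum>k<n. _ k" "\<Sum>l<m. _ l"] sum_product unfolding sum_distrib_left .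
qed

text \<open>Since \<open>ln\<close> is even with \<open>ln 0 = 0\<close>, no positivity of the
  determinant has to be known; \<open>x > 1\<close> settles \<open>t = 0\<close>.\<close>

lemma ln_less_of_abs_less:
  fixes t x :: real
  assumes "\<bar>t\<bar> < x" "x > 1"
  shows "ln t < ln x"
proof (cases "t = 0")
  case True
  then show ?thesis using assms by simp
next
  case False
  have "ln t = ln \<bar>t\<bar>" using ln_minus[of t] by (auto simp: abs_if)
  then show ?thesis using False assms by simp
qed

text \<open>The constants come before the ports and the covariance, which may be arbitrary
  admissible functions of \<omega>: the event of \<open>gauss_event_measure\<close> lies in the
  outage event pointwise. Such functions carry no measurability of their own, hence the premise on
  the outage set.\<close>

lemma outage_probability_ge:
  assumes "Urx \<in> carrier_mat Nr Nr" "Utx \<in> carrier_mat Nt Nt" and "r > 0"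
  obtains c C where "c > 0" "C > 0"
    "\<And>snr s p q K. \<lbrakk>snr > 1; \<And>t. 0 < s t; \<And>t. s t \<le> 1; antimono s;
       C * (\<Prod>t<min nr nt. max 1 (sqrt snr * s t))\<^sup>2 < snr powr r;
       \<And>\<omega>. \<omega> \<in> space (gauss_space Nr Nt) \<Longrightarrow>
         valid_ports nr Nr (p \<omega>) \<and> valid_ports nt Nt (q \<omega>) \<and> admissible_cov nt snr (K \<omega>);
       {\<omega> \<in> space (gauss_space Nr Nt). mimo_rate (sel_mat nr Nr (p \<omega>) *
          channel \<delta> Nr Urx lrx Nt Utx ltx (gauss_mat Nr Nt \<omega>) * transpose_mat (sel_mat nt Nt (q \<omega>))) (K \<omega>)
          < r * ln snr} \<in> sets (gauss_space Nr Nt)\<rbrakk>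
     \<Longrightarrow> c * (\<Prod>i<Nr. \<Prod>j<Nt. (s (min i j))\<^sup>2) \<le> measure (gauss_space Nr Nt)
       {\<omega> \<in> space (gauss_space Nr Nt). mimo_rate (sel_mat nr Nr (p \<omega>) *
          channel \<delta> Nr Urx lrx Nt Utx ltx (gauss_mat Nr Nt \<omega>) * transpose_mat (sel_mat nt Nt (q \<omega>))) (K \<omega>)
          < r * ln snr}"
proof -
  let ?M = "gauss_space Nr Nt" and ?m = "min Nr Nt"
  show ?thesis
  proof (rule channel_entries[OF assms(1,2), where \<delta>=\<delta> and lrx=lrx and ltx=ltx])
    fix cA cB :: real and A B :: "nat \<Rightarrow> nat \<Rightarrow> complex"
    assume cAB: "cA \<ge> 0" "cB \<ge> 0"
      and A: "\<And>x k. x < Nr \<Longrightarrow> k < Nr \<Longrightarrow> norm (A x k) \<le> cA" and B: "\<And>l y. l < Nt \<Longrightarrow> y < Nt \<Longrightarrow> norm (B l y) \<le> cB"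
      and H: "\<And>G x y. G \<in> carrier_mat Nr Nt \<Longrightarrow> x < Nr \<Longrightarrow> y < Nt \<Longrightarrow>
        channel \<delta> Nr Urx lrx Nt Utx ltx G $$ (x, y) = (\<Sum>k<Nr. \<Sum>l<Nt. A x k * G $$ (k, l) * B l y)"
    show ?thesis
    proof (rule gauss_event_measure[of Nr Nt])
      fix c :: real assume "c > 0" and event: "\<And>s. (\<And>t. 0 < s t) \<Longrightarrow> (\<And>t. s t \<le> 1) \<Longrightarrow> \<exists>E\<in>sets ?M.
           c * (\<Prod>i<Nr. \<Prod>j<Nt. (s (min i j))\<^sup>2) \<le> measure ?M E \<and>
           (\<forall>\<omega>\<in>E. \<exists>a b. (\<forall>q<?m. (\<forall>i<Nr. norm (a q i) \<le> 4) \<and> (\<forall>j<Nt. norm (b q j) \<le> 4)) \<and>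
              (\<forall>i<Nr. \<forall>j<Nt. gauss_entry \<omega> i j = (\<Sum>q<?m. of_real (s q) * a q i * b q j)))"
      show ?thesis
      proof (rule norm_det_rate_le[where nr=nr and nt=nt and m="?m" and ca="real Nr * (cA * 4)" and cb="real Nt * (4 * cB)"])
        fix C :: real assume "C > 0" and det_le:
          "\<And>Hb K a b s snr. \<lbrakk>Hb \<in> carrier_mat nr nt; admissible_cov nt snr K; snr > 0;
             \<And>p. s p \<ge> (0::real); antimono s;
             \<And>q i. q < ?m \<Longrightarrow> i < nr \<Longrightarrow> norm (a q i) \<le> real Nr * (cA * 4);
             \<And>q j. q < ?m \<Longrightarrow> j < nt \<Longrightarrow> norm (b q j) \<le> real Nt * (4 * cB);
             \<And>i j. i < nr \<Longrightarrow> j < nt \<Longrightarrow> Hb $$ (i, j) = (\<Sum>q<?m. of_real (s q) * a q i * b q j)\<rbrakk>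
           \<Longrightarrow> norm (Determinant.det (1\<^sub>m nr + Hb * K * mat_adjoint Hb))
             \<le> C * (\<Prod>p<min nr nt. max 1 (sqrt snr * s p))\<^sup>2"
        show ?thesis
        proof (rule that[OF \<open>c > 0\<close> \<open>C > 0\<close>])
          fix snr :: real and s :: "nat \<Rightarrow> real" and p q :: "(nat \<times> nat \<times> bool \<Rightarrow> real) \<Rightarrow> nat \<Rightarrow> nat"
            and K :: "(nat \<times> nat \<times> bool \<Rightarrow> real) \<Rightarrow> complex mat"
          let ?Hb = "\<lambda>\<omega>. sel_mat nr Nr (p \<omega>) * channel \<delta> Nr Urx lrx Nt Utx ltx (gauss_mat Nr Nt \<omega>) *
            transpose_mat (sel_mat nt Nt (q \<omega>))"
          let ?out = "{\<omega> \<in> space ?M. mimo_rate (?Hb \<omega>) (K \<omega>) < r * ln snr}"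
          assume snr: "snr > 1" and s: "\<And>t. 0 < s t" "\<And>t. s t \<le> 1" "antimono s"
            and small: "C * (\<Prod>t<min nr nt. max 1 (sqrt snr * s t))\<^sup>2 < snr powr r"
            and adm: "\<And>\<omega>. \<omega> \<in> space ?M \<Longrightarrow>
               valid_ports nr Nr (p \<omega>) \<and> valid_ports nt Nt (q \<omega>) \<and> admissible_cov nt snr (K \<omega>)"
            and meas: "?out \<in> sets ?M"
          obtain E where E: "E \<in> sets ?M"
            and E': "c * (\<Prod>i<Nr. \<Prod>j<Nt. (s (min i j))\<^sup>2) \<le> measure ?M E \<and>
              (\<forall>\<omega>\<in>E. \<exists>a b. (\<forall>q<?m. (\<forall>i<Nr. norm (a q i) \<le> 4) \<and> (\<forall>j<Nt. norm (b q j) \<le> 4)) \<and>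
                (\<forall>i<Nr. \<forall>j<Nt. gauss_entry \<omega> i j = (\<Sum>q<?m. of_real (s q) * a q i * b q j)))"
            using event[OF s(1,2)] by (rule bexE)
          have "E \<subseteq> ?out"
          proof
            fix \<omega> assume "\<omega> \<in> E"
            then have \<omega>: "\<omega> \<in> space ?M" using sets.sets_into_space[OF E] by blast
            obtain a b where ab': "(\<forall>q<?m. (\<forall>i<Nr. norm (a q i) \<le> 4) \<and> (\<forall>j<Nt. norm (b q j) \<le> 4)) \<and>
                (\<forall>i<Nr. \<forall>j<Nt. gauss_entry \<omega> i j = (\<Sum>q<?m. of_real (s q) * a q i * b q j))"
              using bspec[OF conjunct2[OF E'] \<open>\<omega> \<in> E\<close>] by (elim exE)
            have ab: "norm (a q i) \<le> 4" "norm (b q j) \<le> 4" if "q < ?m" "i < Nr" "j < Nt" for q i j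
              using ab' that by simp_all
            have G: "gauss_entry \<omega> i j = (\<Sum>q<?m. of_real (s q) * a q i * b q j)" if "i < Nr" "j < Nt" for i j
              using ab' that by simp
            have ports: "p \<omega> i < Nr" if "i < nr" for i
              using adm[OF \<omega>] that by (auto simp: valid_ports_def)
            have ports': "q \<omega> j < Nt" if "j < nt" for j
              using adm[OF \<omega>] that by (auto simp: valid_ports_def)
            have Gm: "gauss_mat Nr Nt \<omega> \<in> carrier_mat Nr Nt" by (simp add: gauss_mat_def)
            have Hc: "channel \<delta> Nr Urx lrx Nt Utx ltx (gauss_mat Nr Nt \<omega>) \<in> carrier_mat Nr Nt"
              using assms(1,2) mat_adjoint_carrier[OF assms(2)] by (auto simp: channel_def)
            have S: "sel_mat n N f \<in> carrier_mat n N" for n N f by (simp add: sel_mat_def)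
            have T: "transpose_mat (sel_mat n N f) \<in> carrier_mat N n" for n N f by (simp add: S)
            have Hb: "?Hb \<omega> \<in> carrier_mat nr nt"
              by (rule mult_carrier_mat[OF mult_carrier_mat[OF S Hc] T])
            have dr: "dim_row (?Hb \<omega>) = nr" by (rule carrier_matD(1)[OF Hb])
            let ?a = "\<lambda>t i. \<Sum>k<Nr. A (p \<omega> i) k * a t k" and ?b = "\<lambda>t j. \<Sum>l<Nt. b t l * B l (q \<omega> j)"
            have "?Hb \<omega> $$ (i, j) = (\<Sum>t<?m. of_real (s t) * ?a t i * ?b t j)" if "i < nr" "j < nt" for i j
            proof -
              have "?Hb \<omega> $$ (i, j) = (\<Sum>k<Nr. \<Sum>l<Nt. A (p \<omega> i) k * gauss_mat Nr Nt \<omega> $$ (k, l) * B l (q \<omega> j))"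
                unfolding selection_entry[where p="p \<omega>" and q="q \<omega>", OF Hc that ports[OF that(1)] ports'[OF that(2)]]
                by (rule H[OF Gm ports[OF that(1)] ports'[OF that(2)]])
              also have "\<dots> = (\<Sum>k<Nr. \<Sum>l<Nt. A (p \<omega> i) k * (\<Sum>t<?m. of_real (s t) * a t k * b t l) * B l (q \<omega> j))"
              proof (intro sum.cong refl)
                fix k l assume "k \<in> {..<Nr}" "l \<in> {..<Nt}"
                then have "gauss_mat Nr Nt \<omega> $$ (k, l) = (\<Sum>t<?m. of_real (s t) * a t k * b t l)"
                  using G[of k l] by (simp add: gauss_mat_def gauss_entry_def)
                then show "A (p \<omega> i) k * gauss_mat Nr Nt \<omega> $$ (k, l) * B l (q \<omega> j)
                   = A (p \<omega> i) k * (\<Sum>t<?m. of_real (s t) * a t k * b t l) * B l (q \<omega> j)" by (simp only:)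
              qed
              also have "\<dots> = (\<Sum>t<?m. of_real (s t) * ?a t i * ?b t j)"
                by (rule sum_bilinear_factorization)
              finally show ?thesis .
            qed
            moreover have "norm (?a t i) \<le> real Nr * (cA * 4)" if "t < ?m" "i < nr" for t i
              using that ab(1)[of t _ 0] A ports cAB
              by (intro norm_sum_le_card) (auto simp: norm_mult intro!: mult_mono)
            moreover have "norm (?b t j) \<le> real Nt * (4 * cB)" if "t < ?m" "j < nt" for t j
              using that ab(2)[of t 0] B ports' cAB
              by (intro norm_sum_le_card) (auto simp: norm_mult intro!: mult_mono)
            ultimately have "norm (Determinant.det (1\<^sub>m nr + ?Hb \<omega> * K \<omega> * mat_adjoint (?Hb \<omega>)))
               \<le> C * (\<Prod>p<min nr nt. max 1 (sqrt snr * s p))\<^sup>2"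
              using adm[OF \<omega>] snr s by (intro det_le[OF Hb, where a="?a" and b="?b"]) (auto intro: less_imp_le)
            then have "\<bar>Re (Determinant.det (1\<^sub>m nr + ?Hb \<omega> * K \<omega> * mat_adjoint (?Hb \<omega>)))\<bar> < snr powr r"
              by (rule order_le_less_trans[OF order_trans[OF abs_Re_le_cmod] small])
            then have "mimo_rate (?Hb \<omega>) (K \<omega>) < ln (snr powr r)"
              unfolding mimo_rate_def dr using snr \<open>r > 0\<close>
              by (intro ln_less_of_abs_less) auto
            then show "\<omega> \<in> ?out" using \<omega> snr by (simp add: ln_powr)
          qed
          have "prob_space ?M"
            unfolding gauss_space_def by (intro prob_space_PiM prob_space_normal_density) simp
          then interpret prob_space ?M .
          have "measure ?M E \<le> measure ?M ?out"
            using \<open>E \<subseteq> ?out\<close> meas by (intro finite_measure_mono)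
          then show "c * (\<Prod>i<Nr. \<Prod>j<Nt. (s (min i j))\<^sup>2) \<le> measure ?M ?out"
            using E' by linarith
        qed
      qed
    qed
  qed
qed

section \<open>The outer bound\<close>

lemma two_level_exponents:
  fixes \<alpha> \<beta> :: real
  assumes "0 \<le> \<alpha>" "\<alpha> \<le> \<beta>" "\<beta> \<le> 1"
    and e: "e = (\<lambda>p::nat. \<alpha> * (if k \<le> p then 1 else 0) + (\<beta> - \<alpha>) * (if Suc k \<le> p then 1 else 0))"
  shows "mono e" "0 \<le> e p" "e p \<le> 1"
  using assms by (auto simp: mono_def)

lemma diversity_le_dmt_outer:
  assumes key: "\<And>e. mono e \<Longrightarrow> (\<And>p. 0 \<le> e p) \<Longrightarrow> (\<And>p. e p \<le> 1) \<Longrightarrow> (\<Sum>p<n. 1 - e p) = r \<Longrightarrow>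
      d \<le> (\<Sum>i<Nr. \<Sum>j<Nt. e (min i j))"
    and n: "n \<le> Nr" "n \<le> Nt" and "Np < n" and r: "0 \<le> r" "r \<le> real n"
  shows "d \<le> dmt_outer Nr Nt Np n r"
proof (cases "r \<le> real Np")
  case True
  define k where "k = nat \<lfloor>r\<rfloor>"
  have k: "real k \<le> r" "r < real k + 1" using r(1) by (auto simp: k_def)
  then have kn: "k < n" using True \<open>Np < n\<close> by linarith
  \<comment> \<open>Unit segments: exponent 0 below \<open>k\<close>, \<alpha> at \<open>k\<close>,
    1 above, and \<alpha> makes the rate \<open>k + (1 - \<alpha>)\<close> equal to
    \<open>r\<close>.\<close>
  define \<alpha> where "\<alpha> = real k + 1 - r"
  define e where "e = (\<lambda>p. \<alpha> * (if k \<le> p then 1 else 0) + (1 - \<alpha>) * (if Suc k \<le> p then 1 else (0::real)))"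
  have \<alpha>: "0 \<le> \<alpha>" "\<alpha> \<le> 1" using k by (auto simp: \<alpha>_def)
  have "(\<Sum>p<n. 1 - e p) = r"
    using sum_two_level_rate[OF kn e_def] by (simp add: \<alpha>_def)
  then have "d \<le> (\<Sum>i<Nr. \<Sum>j<Nt. e (min i j))"
    by (intro key two_level_exponents[OF \<alpha>(1) \<alpha>(2) order_refl e_def])
  also have "\<dots> = \<alpha> * dmt_pt Nr Nt k + (1 - \<alpha>) * dmt_pt Nr Nt (Suc k)"
    using kn n by (intro sum_two_level_exponents[OF _ _ e_def]) auto
  also have "\<dots> = dmt_outer Nr Nt Np n r"
    using True by (simp add: dmt_outer_def Let_def k_def[symmetric] \<alpha>_def algebra_simps)
  finally show ?thesis .
next
  case False
  \<comment> \<open>Last segment: a single jump at \<open>Np\<close> to the value \<alpha>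
    determined by \<open>n - \<alpha> * (n - Np) = r\<close>. The second jump has height 0.\<close>
  define \<alpha> where "\<alpha> = (real n - r) / (real n - real Np)"
  define e where "e = (\<lambda>p. \<alpha> * (if Np \<le> p then 1 else 0) + (\<alpha> - \<alpha>) * (if Suc Np \<le> p then 1 else (0::real)))"
  have pos: "real n - real Np > 0" using \<open>Np < n\<close> by simp
  have \<alpha>: "0 \<le> \<alpha>" "\<alpha> \<le> 1" using pos False r by (auto simp: \<alpha>_def)
  have "(\<Sum>p<n. 1 - e p) = real n - \<alpha> * (real n - real Np)"
    using sum_two_level_rate[OF \<open>Np < n\<close> e_def] by (simp add: algebra_simps)
  also have "\<dots> = r" using pos by (simp add: \<alpha>_def)
  finally have "d \<le> (\<Sum>i<Nr. \<Sum>j<Nt. e (min i j))"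
    by (intro key two_level_exponents[OF \<alpha>(1) order_refl \<alpha>(2) e_def])
  also have "\<dots> = \<alpha> * dmt_pt Nr Nt Np + (\<alpha> - \<alpha>) * dmt_pt Nr Nt (Suc Np)"
    using \<open>Np < n\<close> n by (intro sum_two_level_exponents[OF _ _ e_def]) auto
  also have "\<dots> = dmt_outer Nr Nt Np n r"
    using False by (simp add: dmt_outer_def \<alpha>_def)
  finally show ?thesis .
qed

theorem theorem4:
  fixes W1r W2r W1t W2t \<delta> r d :: real
    and N1r N2r N1t N2t Nrx Ntx Nrx' Ntx' nrx ntx nmin Np :: nat
    and Urx Utx :: "complex mat" and lrx ltx :: "nat \<Rightarrow> real"
    and M :: "(nat \<times> nat \<times> bool \<Rightarrow> real) measure"
    and H :: "(nat \<times> nat \<times> bool \<Rightarrow> real) \<Rightarrow> complex mat"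
    and prx ptx :: "real \<Rightarrow> (nat \<times> nat \<times> bool \<Rightarrow> real) \<Rightarrow> nat \<Rightarrow> nat"
    and Kf :: "real \<Rightarrow> (nat \<times> nat \<times> bool \<Rightarrow> real) \<Rightarrow> complex mat"
    and Rate :: "real \<Rightarrow> (nat \<times> nat \<times> bool \<Rightarrow> real) \<Rightarrow> real"
    and Pout :: "real \<Rightarrow> real"
  assumes "W1r > 0" "W2r > 0" "W1t > 0" "W2t > 0"
    and "N1r \<ge> 1" "N2r \<ge> 1" "N1t \<ge> 1" "N2t \<ge> 1"
    and "Nrx = N1r * N2r" "Ntx = N1t * N2t"
    and "Nrx' = corr_rank W1r W2r N1r N2r" "Ntx' = corr_rank W1t W2t N1t N2t"
    and "\<delta> > 0"
    and "eigen_decomp (corr_mat W1r W2r N1r N2r) Nrx Urx lrx"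
    and "eigen_decomp (corr_mat W1t W2t N1t N2t) Ntx Utx ltx"
    and "M = gauss_space Nrx Ntx"
    and "H = (\<lambda>\<omega>. channel \<delta> Nrx Urx lrx Ntx Utx ltx (gauss_mat Nrx Ntx \<omega>))"
    and "1 \<le> nrx" "nrx \<le> Nrx" "1 \<le> ntx" "ntx \<le> Ntx"
    and "nmin = min nrx ntx"
    and "\<And>snr \<omega>. snr > 0 \<Longrightarrow> \<omega> \<in> space M \<Longrightarrow>
           valid_ports nrx Nrx (prx snr \<omega>) \<and> valid_ports ntx Ntx (ptx snr \<omega>) \<and>
           admissible_cov ntx snr (Kf snr \<omega>)"
    and "Rate = (\<lambda>snr \<omega>. mimo_rate
            (sel_mat nrx Nrx (prx snr \<omega>) * H \<omega> * transpose_mat (sel_mat ntx Ntx (ptx snr \<omega>)))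
            (Kf snr \<omega>))"
    and "\<And>snr. snr > 0 \<Longrightarrow> {\<omega> \<in> space M. Rate snr \<omega> < r * ln snr} \<in> sets M"
    and "Pout = (\<lambda>snr. measure M {\<omega> \<in> space M. Rate snr \<omega> < r * ln snr})"
    and "0 \<le> r" "r \<le> real nmin"
    and "((\<lambda>snr. ln (Pout snr) / ln snr) \<longlongrightarrow> - d) at_top"
    and "is_Nprime Nrx' Ntx' nmin Np"
  shows "d \<le> dmt_outer Nrx' Ntx' Np nmin r"
proof -
  have Urx: "Urx \<in> carrier_mat Nrx Nrx" and Utx: "Utx \<in> carrier_mat Ntx Ntx"
    using assms(14,15) by (auto simp: eigen_decomp_def unitary_mat_def)
  have rank: "Nrx' = Nrx" "Ntx' = Ntx"
    using assms(1-12) by (simp_all add: corr_rank_eq)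
  have n: "nmin \<le> Nrx" "nmin \<le> Ntx" and Np: "Np < nmin"
    using assms(19,21,22,30) by (auto simp: is_Nprime_def)
  have "d \<le> dmt_outer Nrx Ntx Np nmin r"
  proof (cases "r = 0")
    case True
    \<comment> \<open>No rate strictly below \<open>r\<close> is available at \<open>r = 0\<close>.
      The outage probability is 0 there, and \<open>ln 0 = 0\<close> makes the limit 0, so
      \<open>d = 0\<close> lies below the value \<open>Nrx * Ntx\<close> of the bound.\<close>
    have "Pout snr = 0" if "snr > 1" for snr
    proof -
      have "0 \<le> Rate snr \<omega>" if "\<omega> \<in> space M" for \<omega>
      proof -
        have "sel_mat nrx Nrx (prx snr \<omega>) * H \<omega> * transpose_mat (sel_mat ntx Ntx (ptx snr \<omega>))
            \<in> carrier_mat nrx ntx"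
          by (rule carrier_matI) (simp_all add: sel_mat_def)
        then show ?thesis
          unfolding assms(24) using assms(23)[of snr \<omega>] that \<open>snr > 1\<close> by (intro mimo_rate_nonneg) auto
      qed
      then have empty: "{\<omega> \<in> space M. Rate snr \<omega> < r * ln snr} = {}"
        using True by (auto simp: not_less)
      show ?thesis by (simp only: assms(26) empty measure_empty)
    qed
    then have "eventually (\<lambda>snr. ln (Pout snr) / ln snr = 0) at_top"
      by (intro eventually_mono[OF eventually_gt_at_top[of 1]]) simp
    then have "((\<lambda>snr. ln (Pout snr) / ln snr) \<longlongrightarrow> 0) at_top"
      by (rule tendsto_eventually)
    then have "- d = 0" using tendsto_unique[OF _ assms(29)] by simp
    moreover have "dmt_outer Nrx Ntx Np nmin r = real Nrx * real Ntx"
      using True by (simp add: dmt_outer_def dmt_pt_def)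
    ultimately show ?thesis by simp
  next
    case False
    then have "r > 0" using assms(27) by simp
    show ?thesis
    proof (rule outage_probability_ge[OF Urx Utx \<open>r > 0\<close>, where nr=nrx and nt=ntx and \<delta>=\<delta> and lrx=lrx and ltx=ltx])
      fix c C :: real
      assume "c > 0" "C > 0" and prob: "\<And>snr s p q K. \<lbrakk>snr > 1; \<And>t. 0 < s t; \<And>t. s t \<le> 1; antimono s;
         C * (\<Prod>t<min nrx ntx. max 1 (sqrt snr * s t))\<^sup>2 < snr powr r;
         \<And>\<omega>. \<omega> \<in> space (gauss_space Nrx Ntx) \<Longrightarrow>
           valid_ports nrx Nrx (p \<omega>) \<and> valid_ports ntx Ntx (q \<omega>) \<and> admissible_cov ntx snr (K \<omega>);
         {\<omega> \<in> space (gauss_space Nrx Ntx). mimo_rate (sel_mat nrx Nrx (p \<omega>) *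
            channel \<delta> Nrx Urx lrx Ntx Utx ltx (gauss_mat Nrx Ntx \<omega>) * transpose_mat (sel_mat ntx Ntx (q \<omega>))) (K \<omega>)
            < r * ln snr} \<in> sets (gauss_space Nrx Ntx)\<rbrakk>
       \<Longrightarrow> c * (\<Prod>i<Nrx. \<Prod>j<Ntx. (s (min i j))\<^sup>2) \<le> measure (gauss_space Nrx Ntx)
         {\<omega> \<in> space (gauss_space Nrx Ntx). mimo_rate (sel_mat nrx Nrx (p \<omega>) *
            channel \<delta> Nrx Urx lrx Ntx Utx ltx (gauss_mat Nrx Ntx \<omega>) * transpose_mat (sel_mat ntx Ntx (q \<omega>))) (K \<omega>)
            < r * ln snr}"
      have outage: "c * (\<Prod>i<Nrx. \<Prod>j<Ntx. (s (min i j))\<^sup>2) \<le> Pout snr"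
        if "snr > 1" "\<And>t. 0 < s t" "\<And>t. s t \<le> 1" "antimono s"
          "C * (\<Prod>t<nmin. max 1 (sqrt snr * s t))\<^sup>2 < snr powr r" for snr s
      proof -
        have "snr > 0" using that by simp
        show ?thesis
          unfolding assms(26,24,17,16)
          by (rule prob[OF that(1-4) that(5)[unfolded assms(22)]
            assms(23)[OF \<open>snr > 0\<close>, unfolded assms(16)]
            assms(25)[OF \<open>snr > 0\<close>, unfolded assms(24,17,16)]])
      qed
      show ?thesis
        by (rule diversity_le_dmt_outer[OF _ n Np assms(27,28)],
          rule diversity_le_of_exponents[OF \<open>c > 0\<close> \<open>C > 0\<close> outage assms(29) _ _ _ _ \<open>r > 0\<close>])
    qed
  qed
  then show ?thesis by (simp add: rank)
qed

end
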